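(* Let $p\ge1$, $\mathbf n=(n_1,\dots,n_d)\in\mathbb{N}^d$, $\mathbf A\in\mathbb{R}^{\mathbf n^{\times2}}$, let $X^{(1)}\in\mathbb{R}^{n_1},\dots,X^{(d)}\in\mathbb{R}^{n_d}$ be independent random vectors with independent mean $0$, variance $1$ entries, and let $\bar X^{(1)},\dots,\bar X^{(d)}$ be corresponding independent copies. Then $$\left\|\sum_{\mathbf i,\mathbf i'\in\mathbf J^{\mathbf n}}A_{\mathbf i\dot+\mathbf i'}\prod_{l\in[d]}X^{(l)}_{\mathbf i_l}X^{(l)}_{\mathbf i'_l}-\mathbb{E}\sum_{\mathbf i,\mathbf i'\in\mathbf J^{\mathbf n}}A_{\mathbf i\dot+\mathbf i'}\prod_{l\in[d]}X^{(l)}_{\mathbf i_l}X^{(l)}_{\mathbf i'_l}\right\|_{L_p}$$ $$\le\sum_{\substack{I,J\subset[d]:\\ J\subset I,\ I\setminus J\ne[d]}}4^{d-|I|}\left\|\sum_{\substack{\mathbf i\in\mathbf J^{\mathbf n}(J)\\ \mathbf j\in\mathbf J^{\mathbf n}(I\setminus J)\\ \mathbf k,\mathbf k'\in\mathbf J^{\mathbf n}(I^c)}}A_{(\mathbf i\dot\times\mathbf j\dot\times\mathbf k)\dot+(\mathbf i\dot\times\mathbf j\dot\times\mathbf k')}\prod_{l\in J}\left[(X^{(l)}_{\mathbf i_l})^2-1\right]\prod_{l\in I^c}X^{(l)}_{\mathbf k_l}\bar X^{(l)}_{\mathbf k'_l}\right\|_{L_p},$$ where $I^c=[d]\setminus 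I$.
   Context: $[d]=\{1,\dots,d\}$. For $\mathbf n\in\mathbb{N}^d$ and $I\subset[d]$, $\mathbf J^{\mathbf n}(I)$ is the set of functions $\mathbf i:I\to\mathbb{N}$ with $\mathbf i_l:=\mathbf i(l)\in[n_l]$ for $l\in I$ (a one-element set if $I=\emptyset$); $\mathbf J^{\mathbf n}:=\mathbf J^{\mathbf n}([d])$. $\mathbf n^{\times2}:=(n_1,\dots,n_d,n_1,\dots,n_d)$, and $\mathbb{R}^{\mathbf n^{\times2}}$ is the set of arrays $\mathbf A:\mathbf J^{\mathbf n^{\times2}}\to\mathbb{R}$ of order $2d$ with entries $A_{\mathbf i}$. For disjoint $I,J\subset[d]$, $\mathbf i\in\mathbf J^{\mathbf n}(I)$, $\mathbf j\in\mathbf J^{\mathbf n}(J)$, the index $\mathbf i\dot\times\mathbf j\in\mathbf J^{\mathbf n}(I\cup J)$ equals $\mathbf i_l$ at $l\in I$ and $\mathbf j_l$ at $l\in J$. For $\mathbf i,\mathbf i'\in\mathbf J^{\mathbf n}$, the index $\mathbf i\dot+\mathbf i'\in\mathbf J^{\mathbf n^{\times2}}$ equals $\mathbf i_l$ at $l\in[d]$ and $\mathbf i'_{l-d}$ at $l\in\{d+1,\dots,2d\}$. $\|Y\|_{L_p}:=(\mathbb{E}|Y|^p)^{1/p}$. "Corresponding independent copies" means $X^{(1)},\dots,X^{(d)},\bar X^{(1)},\dots,\bar X^{(d)}$ are independent and $\bar X^{(l)}$ has the same distribution as $X^{(l)}$. *)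

theory Defs
  imports "HOL-Probability.Probability"
begin

text \<open>
  The set of multi-indices on a set of positions \<open>I\<close>. Functions on \<open>I\<close> are extensional,
  so the set has exactly one element when \<open>I = {}\<close>.
\<close>
definition multi_idx :: "(nat \<Rightarrow> nat) \<Rightarrow> nat set \<Rightarrow> (nat \<Rightarrow> nat) set" where
  "multi_idx n I = (\<Pi>\<^sub>E l\<in>I. {1..n l})"

definition times2 :: "nat \<Rightarrow> (nat \<Rightarrow> nat) \<Rightarrow> nat \<Rightarrow> nat" where
  "times2 d n l = (if l \<le> d then n l else n (l - d))"

definition dot_plus :: "nat \<Rightarrow> (nat \<Rightarrow> nat) \<Rightarrow> (nat \<Rightarrow> nat) \<Rightarrow> nat \<Rightarrow> nat" where
  "dot_plus d i i' =
     (\<lambda>l\<in>{1..2 * d}. if l \<le> d then i l else i' (l - d))"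

text \<open>
  An array of order \<open>2 * d\<close> is a function \<open>A :: (nat \<Rightarrow> nat) \<Rightarrow> real\<close>, of which only the values
  on \<open>multi_idx (times2 d n) {1..2 * d}\<close> matter. The combined index of two
  indices on disjoint position sets \<open>I\<close> and \<open>J\<close> is the library's \<open>merge I J (i, j)\<close>.
\<close>
lemma dot_plus_in_multi_idx:
  assumes "i \<in> multi_idx n {1..d}" "i' \<in> multi_idx n {1..d}"
  shows "dot_plus d i i' \<in> multi_idx (times2 d n) {1..2 * d}"
  unfolding multi_idx_def dot_plus_def
proof (rule restrict_PiE_iff[THEN iffD2], intro ballI)
  fix l assume l: "l \<in> {1..2 * d}"
  show "(if l \<le> d then i l else i' (l - d)) \<in> {1..times2 d n l}"
  proof (cases "l \<le> d")
    case True
    with l have "l \<in> {1..d}" by simp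
    with assms(1) have "i l \<in> {1..n l}" unfolding multi_idx_def by (rule PiE_mem)
    with True show ?thesis by (simp add: times2_def)
  next
    case False
    with l have "l - d \<in> {1..d}" by auto
    with assms(2) have "i' (l - d) \<in> {1..n (l - d)}" unfolding multi_idx_def by (rule PiE_mem)
    with False show ?thesis by (simp add: times2_def)
  qed
qed

text \<open>
  The norm takes values in \<open>ennreal\<close>, since no \<open>p\<close>-th moments are assumed and it may be infinite.
\<close>
definition Lp_norm :: "'a measure \<Rightarrow> real \<Rightarrow> ('a \<Rightarrow> real) \<Rightarrow> ennreal" where
  "Lp_norm M p Y =
     (let m = (\<integral>\<^sup>+ \<omega>. ennreal (\<bar>Y \<omega>\<bar> powr p) \<partial>M)
      in if m = \<infinity> then \<infinity> else ennreal (enn2real m powr (1 / p)))"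

text \<open>
  \<open>Y j\<close> is the \<open>j\<close>-th entry of a random vector with entries \<open>1, \<dots>, m\<close>. Its value space is
  the product Borel space on the extensional functions on \<open>{1..m}\<close>.
\<close>
definition vec_space :: "nat \<Rightarrow> (nat \<Rightarrow> real) measure" where
  "vec_space m = (\<Pi>\<^sub>M j\<in>{1..m}. borel)"

definition rand_vec :: "nat \<Rightarrow> (nat \<Rightarrow> 'a \<Rightarrow> real) \<Rightarrow> 'a \<Rightarrow> nat \<Rightarrow> real" where
  "rand_vec m Y \<omega> = (\<lambda>j\<in>{1..m}. Y j \<omega>)"

definition indep_standardized_entries ::
  "'a measure \<Rightarrow> nat \<Rightarrow> (nat \<Rightarrow> 'a \<Rightarrow> real) \<Rightarrow> bool" where
  "indep_standardized_entries M m Y \<longleftrightarrow>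
     prob_space.indep_vars M (\<lambda>_. borel) Y {1..m} \<and>
     (\<forall>j\<in>{1..m}. integrable M (Y j) \<and> prob_space.expectation M (Y j) = 0 \<and>
                 prob_space.variance M (Y j) = 1)"

definition indep_rand_vecs ::
  "'a measure \<Rightarrow> nat \<Rightarrow> (nat \<Rightarrow> nat) \<Rightarrow> (nat \<Rightarrow> nat \<Rightarrow> 'a \<Rightarrow> real) \<Rightarrow> bool" where
  "indep_rand_vecs M d n X \<longleftrightarrow>
     prob_space.indep_vars M (\<lambda>l. vec_space (n l)) (\<lambda>l. rand_vec (n l) (X l)) {1..d}"

definition corresponding_indep_copies ::
  "'a measure \<Rightarrow> nat \<Rightarrow> (nat \<Rightarrow> nat) \<Rightarrow> (nat \<Rightarrow> nat \<Rightarrow> 'a \<Rightarrow> real)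
     \<Rightarrow> (nat \<Rightarrow> nat \<Rightarrow> 'a \<Rightarrow> real) \<Rightarrow> bool" where
  "corresponding_indep_copies M d n X Xbar \<longleftrightarrow>
     prob_space.indep_vars M
       (case_sum (\<lambda>l. vec_space (n l)) (\<lambda>l. vec_space (n l)))
       (case_sum (\<lambda>l. rand_vec (n l) (X l)) (\<lambda>l. rand_vec (n l) (Xbar l)))
       ({1..d} <+> {1..d}) \<and>
     (\<forall>l\<in>{1..d}. distr M (vec_space (n l)) (rand_vec (n l) (Xbar l)) =
                 distr M (vec_space (n l)) (rand_vec (n l) (X l)))"

end

theory Submission
  imports Defs
begin

text \<open>
  In every mode \<open>l\<close> a product of two entries splits as
  \<open>X\<^sub>a X\<^sub>b = [a = b] (X\<^sub>a\<^sup>2 - 1) + [a = b] + [a \<noteq> b] X\<^sub>a X\<^sub>b\<close>.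
  Expanding the product over the modes writes the quadratic form as a sum over pairs \<open>J \<subseteq> I\<close>, where
  \<open>I\<close> collects the modes on the diagonal and \<open>J\<close> those among them that contribute a centred square
  (\<open>sum_chaos_terms\<close>). The term with \<open>I = {1..d}\<close> and \<open>J = {}\<close> is the only constant one, and it is
  the expectation (\<open>expectation_quadratic_form\<close>). By the triangle inequality it remains to bound
  each other term, in which the two indices differ in all modes outside \<open>I\<close>, by the corresponding
  term with all index pairs admitted and the second factor taken from the independent copy.

  The factor 4 per mode comes from random index sets: a uniformly random \<open>S\<close> satisfies \<open>a \<in> S\<close> and
  \<open>b \<notin> S\<close> with probability \<open>1/4\<close> if \<open>a \<noteq> b\<close> and never if \<open>a = b\<close>. An off-diagonal term is
  therefore \<open>4 ^ (d - card I)\<close> times an average, over independent choices of sets \<open>S l\<close>, of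
  terms restricted to \<open>a \<in> S l\<close>, \<open>b \<notin> S l\<close> (\<open>chaos_term_offdiag_avg\<close>). For fixed sets, the first and
  the second factor read disjoint groups of independent entries, so replacing the second group by its
  copy does not change the law (\<open>swap_original_copy\<close>). The decoupled restricted term arises from the
  decoupled full term by setting some coordinates to zero. The full term is affine in each of these
  coordinates, and they are centred and independent of the rest, so by Jensen's inequality
  the norm can only decrease (\<open>Lp_norm_zero_on_le\<close>). That is why the full sum, with its diagonal, may
  appear on the right-hand side.

  Both steps are carried out on the product space of all original and copied entries;
  \<open>distr_sample\<close> identifies the joint law of the given vectors with such a product.
\<close>

section \<open>Norms\<close>

text \<open>
  On positive arguments this is the convexity of \<open>powr\<close>. At the origin it reduces to
  \<open>s powr p \<le> s\<close> for \<open>0 < s < 1\<close>.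
\<close>
lemma convex_on_abs_powr:
  fixes p :: real
  assumes p: "p \<ge> 1"
  shows "convex_on UNIV (\<lambda>x::real. \<bar>x\<bar> powr p)"
proof (rule convex_onI)
  fix t x y :: real
  assume t: "0 < t" "t < 1"
  define a b where "a = \<bar>x\<bar>" and "b = \<bar>y\<bar>"
  have nonneg: "a \<ge> 0" "b \<ge> 0" by (auto simp: a_def b_def)
  have shrink: "(s * c) powr p \<le> s * c powr p" if "0 < s" "s < 1" "c \<ge> 0" for s c :: real
  proof -
    have "s powr p \<le> s powr 1"
      using that p by (intro powr_mono') auto
    then show ?thesis
      using that by (auto simp: powr_mult intro!: mult_right_mono)
  qed
  have "\<bar>(1 - t) *\<^sub>R x + t *\<^sub>R y\<bar> \<le> \<bar>(1 - t) *\<^sub>R x\<bar> + \<bar>t *\<^sub>R y\<bar>" by (rule abs_triangle_ineq)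
  also have "\<dots> = (1 - t) * a + t * b"
    using t by (simp add: abs_mult a_def b_def)
  finally have "\<bar>(1 - t) *\<^sub>R x + t *\<^sub>R y\<bar> powr p \<le> ((1 - t) * a + t * b) powr p"
    using p by (intro powr_mono2) auto
  also have "\<dots> \<le> (1 - t) * a powr p + t * b powr p"
  proof (cases "a = 0 \<or> b = 0")
    case True
    then show ?thesis using shrink[of "1 - t" a] shrink[of t b] t nonneg p by auto
  next
    case False
    then show ?thesis
      using convex_onD[OF powr_convex[OF p], of t a b] t nonneg by auto
  qed
  finally show "\<bar>(1 - t) *\<^sub>R x + t *\<^sub>R y\<bar> powr p
      \<le> (1 - t) * \<bar>x\<bar> powr p + t * \<bar>y\<bar> powr p"
    by (simp add: a_def b_def)
qed simp

text \<open>
  Comparison with a finite constant turns norm inequalities into inequalities between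
  nonnegative integrals, with no case distinction on whether the moment is finite.
\<close>
lemma Lp_norm_le_iff:
  assumes "p > 0" "c \<ge> 0"
  shows "Lp_norm M p Y \<le> ennreal c \<longleftrightarrow>
    (\<integral>\<^sup>+ \<omega>. ennreal (\<bar>Y \<omega>\<bar> powr p) \<partial>M) \<le> ennreal (c powr p)"
proof -
  define m where "m = (\<integral>\<^sup>+ \<omega>. ennreal (\<bar>Y \<omega>\<bar> powr p) \<partial>M)"
  show ?thesis
  proof (cases "m = \<infinity>")
    case True
    then show ?thesis using assms
      by (simp add: Lp_norm_def m_def top_unique)
  next
    case False
    then obtain r where r: "m = ennreal r" "r \<ge> 0"
      by (cases m) auto
    have "r powr (1 / p) \<le> c \<longleftrightarrow> r \<le> c powr p"
    proof
      assume "r powr (1 / p) \<le> c"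
      then have "(r powr (1 / p)) powr p \<le> c powr p"
        using assms by (intro powr_mono2) auto
      then show "r \<le> c powr p" using assms r by (simp add: powr_powr)
    next
      assume "r \<le> c powr p"
      then have "r powr (1 / p) \<le> (c powr p) powr (1 / p)"
        using assms r by (intro powr_mono2) auto
      then show "r powr (1 / p) \<le> c" using assms r by (simp add: powr_powr)
    qed
    then show ?thesis using r assms False
      by (simp add: Lp_norm_def m_def[symmetric] Let_def)
  qed
qed

lemma Lp_norm_mono:
  assumes "p > 0"
    and "(\<integral>\<^sup>+ \<omega>. ennreal (\<bar>Y \<omega>\<bar> powr p) \<partial>M) \<le> (\<integral>\<^sup>+ \<omega>. ennreal (\<bar>Y' \<omega>\<bar> powr p) \<partial>N)"
  shows "Lp_norm M p Y \<le> Lp_norm N p Y'"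
proof (cases "Lp_norm N p Y'")
  case (real c)
  then show ?thesis
    using assms Lp_norm_le_iff[of p c N Y'] Lp_norm_le_iff[of p c M Y] by auto
qed simp

lemma Lp_norm_distr:
  assumes "Z \<in> measurable M N" "F \<in> borel_measurable N"
  shows "Lp_norm (distr M N Z) p F = Lp_norm M p (\<lambda>\<omega>. F (Z \<omega>))"
  using assms by (simp add: Lp_norm_def nn_integral_distr)

lemma Lp_norm_zero:
  assumes "p > 0"
  shows "Lp_norm M p (\<lambda>_. 0) = 0"
  using assms by (simp add: Lp_norm_def)

lemma Lp_norm_cmult_le:
  assumes "p > 0" and [measurable]: "Y \<in> borel_measurable M"
  shows "Lp_norm M p (\<lambda>\<omega>. a * Y \<omega>) \<le> ennreal \<bar>a\<bar> * Lp_norm M p Y"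
proof (cases "a = 0")
  case True
  then show ?thesis using assms by (simp add: Lp_norm_zero)
next
  case False
  show ?thesis
  proof (cases "Lp_norm M p Y")
    case (real c)
    have "(\<integral>\<^sup>+ \<omega>. ennreal (\<bar>a * Y \<omega>\<bar> powr p) \<partial>M)
        = ennreal (\<bar>a\<bar> powr p) * (\<integral>\<^sup>+ \<omega>. ennreal (\<bar>Y \<omega>\<bar> powr p) \<partial>M)"
      by (simp add: abs_mult powr_mult ennreal_mult nn_integral_cmult)
    also have "\<dots> \<le> ennreal (\<bar>a\<bar> powr p) * ennreal (c powr p)"
      using Lp_norm_le_iff[of p c M Y] real assms by (intro mult_left_mono) auto
    also have "\<dots> = ennreal ((\<bar>a\<bar> * c) powr p)"
      using real by (simp add: powr_mult ennreal_mult)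
    finally have "Lp_norm M p (\<lambda>\<omega>. a * Y \<omega>) \<le> ennreal (\<bar>a\<bar> * c)"
      using real assms by (subst Lp_norm_le_iff) auto
    then show ?thesis using real by (simp add: ennreal_mult)
  next
    case top
    then show ?thesis using False by (simp add: ennreal_mult_top)
  qed
qed

text \<open>
  Minkowski's inequality, from the convexity of \<open>\<bar>x\<bar> powr p\<close> applied to the convex combination
  \<open>(Y + Y') / (u + v) = (u / (u + v)) (Y / u) + (v / (u + v)) (Y' / v)\<close> with \<open>u\<close>, \<open>v\<close> slightly above
  the two norms.
\<close>
lemma Lp_norm_triangle:
  assumes p: "p \<ge> 1"
    and [measurable]: "Y \<in> borel_measurable M" "Y' \<in> borel_measurable M"
  shows "Lp_norm M p (\<lambda>\<omega>. Y \<omega> + Y' \<omega>) \<le> Lp_norm M p Y + Lp_norm M p Y'"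
proof (cases "Lp_norm M p Y = \<infinity> \<or> Lp_norm M p Y' = \<infinity>")
  case True
  then show ?thesis by auto
next
  case False
  then obtain a b where a: "Lp_norm M p Y = ennreal a" "a \<ge> 0"
    and b: "Lp_norm M p Y' = ennreal b" "b \<ge> 0"
    by (metis ennreal_cases infinity_ennreal_def)
  have "Lp_norm M p (\<lambda>\<omega>. Y \<omega> + Y' \<omega>) \<le> ennreal (a + b) + ennreal e" if "e > 0" for e
  proof -
    \<comment> \<open>Half of \<open>e\<close> in each summand keeps \<open>u\<close> and \<open>v\<close> positive even when a norm vanishes.\<close>
    define u v where "u = a + e / 2" and "v = b + e / 2"
    have uv: "u > 0" "v > 0" "u + v = a + b + e" using a b that by (auto simp: u_def v_def)
    define t where "t = v / (u + v)"
    have t: "0 \<le> t" "t \<le> 1" "1 - t = u / (u + v)" using uv by (auto simp: t_def field_simps)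
    have Y: "(\<integral>\<^sup>+ \<omega>. ennreal (\<bar>Y \<omega>\<bar> powr p) \<partial>M) \<le> ennreal (u powr p)"
      using Lp_norm_le_iff[of p u M Y] a uv that p by (simp add: u_def)
    have Y': "(\<integral>\<^sup>+ \<omega>. ennreal (\<bar>Y' \<omega>\<bar> powr p) \<partial>M) \<le> ennreal (v powr p)"
      using Lp_norm_le_iff[of p v M Y'] b uv that p by (simp add: v_def)
    define C D where "C = (u + v) powr p * ((1 - t) / u powr p)"
      and "D = (u + v) powr p * (t / v powr p)"
    have CD: "C \<ge> 0" "D \<ge> 0" using t uv by (auto simp: C_def D_def)
    have "\<bar>Y \<omega> + Y' \<omega>\<bar> powr p \<le> C * \<bar>Y \<omega>\<bar> powr p + D * \<bar>Y' \<omega>\<bar> powr p" for \<omega>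
    proof -
      have "(1 - t) *\<^sub>R (Y \<omega> / u) + t *\<^sub>R (Y' \<omega> / v) = (Y \<omega> + Y' \<omega>) / (u + v)"
      proof -
        have "(1 - t) * (Y \<omega> / u) = Y \<omega> / (u + v)"
          unfolding t(3) using uv(1,2) by simp
        moreover have "t * (Y' \<omega> / v) = Y' \<omega> / (u + v)"
          unfolding t_def using uv(1,2) by simp
        ultimately show ?thesis by (simp only: real_scaleR_def add_divide_distrib)
      qed
      then have "\<bar>(Y \<omega> + Y' \<omega>) / (u + v)\<bar> powr p
          \<le> (1 - t) * \<bar>Y \<omega> / u\<bar> powr p + t * \<bar>Y' \<omega> / v\<bar> powr p"
        using convex_onD[OF convex_on_abs_powr[OF p] t(1,2), of "Y \<omega> / u" "Y' \<omega> / v"] by simp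
      moreover have scale: "\<bar>z / c\<bar> powr p = \<bar>z\<bar> powr p / c powr p" if "c > 0" for z c :: real
        using that by (simp add: powr_divide)
      moreover have "(u + v) powr p > 0" using uv(1,2) by simp
      ultimately have "\<bar>Y \<omega> + Y' \<omega>\<bar> powr p
          \<le> ((1 - t) * (\<bar>Y \<omega>\<bar> powr p / u powr p) + t * (\<bar>Y' \<omega>\<bar> powr p / v powr p)) * (u + v) powr p"
        using uv(1,2) by (simp only: scale add_pos_pos pos_divide_le_eq)
      also have "\<dots> = C * \<bar>Y \<omega>\<bar> powr p + D * \<bar>Y' \<omega>\<bar> powr p"
        unfolding C_def D_def
        by (simp add: distrib_left mult_ac)
      finally show ?thesis .
    qed
    then have "(\<integral>\<^sup>+ \<omega>. ennreal (\<bar>Y \<omega> + Y' \<omega>\<bar> powr p) \<partial>M)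
        \<le> (\<integral>\<^sup>+ \<omega>. ennreal C * ennreal (\<bar>Y \<omega>\<bar> powr p) + ennreal D * ennreal (\<bar>Y' \<omega>\<bar> powr p) \<partial>M)"
      using CD by (intro nn_integral_mono)
        (auto simp flip: ennreal_mult ennreal_plus intro!: ennreal_leI)
    also have "\<dots> = ennreal C * (\<integral>\<^sup>+ \<omega>. ennreal (\<bar>Y \<omega>\<bar> powr p) \<partial>M)
        + ennreal D * (\<integral>\<^sup>+ \<omega>. ennreal (\<bar>Y' \<omega>\<bar> powr p) \<partial>M)"
      by (simp add: nn_integral_add nn_integral_cmult)
    also have "\<dots> \<le> ennreal C * ennreal (u powr p) + ennreal D * ennreal (v powr p)"
      using Y Y' by (intro add_mono mult_left_mono) auto
    also have "\<dots> = ennreal (C * u powr p + D * v powr p)"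
      using CD by (simp flip: ennreal_mult ennreal_plus)
    also have "C * u powr p + D * v powr p = (u + v) powr p"
    proof -
      have "u powr p \<noteq> 0" "v powr p \<noteq> 0" using uv(1,2) by auto
      then have "C * u powr p = (u + v) powr p * (1 - t)" "D * v powr p = (u + v) powr p * t"
        unfolding C_def D_def by (simp_all only: mult.assoc times_divide_eq_left nonzero_mult_div_cancel_right not_False_eq_True)
      then show ?thesis by (simp only: distrib_left[symmetric] diff_add_cancel mult_1_right)
    qed
    finally have "Lp_norm M p (\<lambda>\<omega>. Y \<omega> + Y' \<omega>) \<le> ennreal (u + v)"
      using p uv(1,2) Lp_norm_le_iff[of p "u + v" M "\<lambda>\<omega>. Y \<omega> + Y' \<omega>"] by simp
    also have "\<dots> = ennreal (a + b) + ennreal e"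
      unfolding uv(3) using a(2) b(2) that by (subst ennreal_plus) simp_all
    finally show ?thesis .
  qed
  then have "Lp_norm M p (\<lambda>\<omega>. Y \<omega> + Y' \<omega>) \<le> ennreal (a + b)"
    by (rule ennreal_le_epsilon)
  then show ?thesis unfolding a(1) b(1) using a(2) b(2) by simp
qed

lemma Lp_norm_sum_le:
  assumes p: "p \<ge> 1" and "finite S"
    and "\<And>s. s \<in> S \<Longrightarrow> Y s \<in> borel_measurable M"
  shows "Lp_norm M p (\<lambda>\<omega>. \<Sum>s\<in>S. Y s \<omega>) \<le> (\<Sum>s\<in>S. Lp_norm M p (Y s))"
  using assms(2,3)
proof (induction S rule: finite_induct)
  case empty
  then show ?case using p by (simp add: Lp_norm_zero)
next
  case (insert s S)
  have "Lp_norm M p (\<lambda>\<omega>. Y s \<omega> + (\<Sum>s\<in>S. Y s \<omega>))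
      \<le> Lp_norm M p (Y s) + Lp_norm M p (\<lambda>\<omega>. \<Sum>s\<in>S. Y s \<omega>)"
    using insert.prems by (intro Lp_norm_triangle p borel_measurable_sum) auto
  also have "\<dots> \<le> Lp_norm M p (Y s) + (\<Sum>s\<in>S. Lp_norm M p (Y s))"
    using insert by (intro add_left_mono) auto
  finally show ?case using insert by simp
qed

section \<open>Setting centred coordinates to zero\<close>

text \<open>
  Jensen's inequality, as \<open>a\<close> is the mean of \<open>a + b * Y\<close>. When the right-hand integrand is not
  integrable, the integral is infinite.
\<close>
lemma abs_powr_le_centered_integral:
  fixes a b p :: real
  assumes "prob_space N" "p \<ge> 1" "integrable N Y" "prob_space.expectation N Y = 0"
  shows "ennreal (\<bar>a\<bar> powr p) \<le> (\<integral>\<^sup>+ \<omega>. ennreal (\<bar>a + b * Y \<omega>\<bar> powr p) \<partial>N)"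
proof -
  interpret prob_space N by fact
  note [measurable] = borel_measurable_integrable[OF assms(3)]
  show ?thesis
  proof (cases "integrable N (\<lambda>\<omega>. \<bar>a + b * Y \<omega>\<bar> powr p)")
    case True
    have "\<bar>expectation (\<lambda>\<omega>. a + b * Y \<omega>)\<bar> powr p \<le> expectation (\<lambda>\<omega>. \<bar>a + b * Y \<omega>\<bar> powr p)"
      using True assms by (intro jensens_inequality[where I=UNIV] convex_on_abs_powr) auto
    moreover have "expectation (\<lambda>\<omega>. a + b * Y \<omega>) = a"
      using assms by (simp add: prob_space)
    ultimately show ?thesis
      using True by (simp add: nn_integral_eq_integral ennreal_leI)
  next
    case False
    then have "(\<integral>\<^sup>+ \<omega>. ennreal (\<bar>a + b * Y \<omega>\<bar> powr p) \<partial>N) = \<infinity>"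
      by (subst (asm) integrable_iff_bounded) (auto simp: not_less top_unique)
    then show ?thesis by simp
  qed
qed

lemma measurable_zero_coordinate:
  assumes "\<And>k. sets (\<mu> k) = sets (borel :: real measure)" "i \<in> K"
  shows "(\<lambda>x. x(i := 0)) \<in> measurable (PiM K \<mu>) (PiM K \<mu>)"
proof (rule measurable_PiM_single')
  fix k assume "k \<in> K"
  then show "(\<lambda>x. (x(i := 0)) k) \<in> measurable (PiM K \<mu>) (\<mu> k)"
    using assms(1)[of k] by (cases "k = i") (simp_all add: sets_eq_imp_space_eq[OF assms(1)])
next
  show "(\<lambda>x. x(i := 0)) \<in> space (PiM K \<mu>) \<rightarrow> (\<Pi>\<^sub>E k\<in>K. space (\<mu> k))"
    using assms(2) by (auto simp: space_PiM sets_eq_imp_space_eq[OF assms(1)] PiE_def extensional_def)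
qed

text \<open>
  The coefficients may depend on the remaining coordinates of \<open>x\<close>.
\<close>
definition affine_in :: "'i \<Rightarrow> (('i \<Rightarrow> real) \<Rightarrow> real) \<Rightarrow> bool" where
  "affine_in k F \<longleftrightarrow> (\<forall>x. \<exists>a c. \<forall>y. F (x(k := y)) = a + c * y)"

lemma affine_inE:
  assumes "affine_in k F"
  obtains a c where "\<And>y. F (x(k := y)) = a + c * y"
  using assms that unfolding affine_in_def by metis

text \<open>
  Integrating out the \<open>i\<close>-th coordinate first, with all others fixed, reduces the claim
  to \<open>abs_powr_le_centered_integral\<close>.
\<close>
lemma Lp_norm_zero_coordinate_le:
  fixes F :: "('i \<Rightarrow> real) \<Rightarrow> real"
  assumes p: "p \<ge> 1" and K: "finite K" "i \<in> K"
    and \<mu>: "\<And>k. prob_space (\<mu> k)" "\<And>k. sets (\<mu> k) = sets borel"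
    and centered: "integrable (\<mu> i) (\<lambda>y. y)" "(\<integral>y. y \<partial>\<mu> i) = 0"
    and F[measurable]: "F \<in> borel_measurable (PiM K \<mu>)"
    and affine: "affine_in i F"
  shows "Lp_norm (PiM K \<mu>) p (\<lambda>x. F (x(i := 0))) \<le> Lp_norm (PiM K \<mu>) p F"
proof -
  interpret product_prob_space \<mu> by (intro product_prob_spaceI \<mu>)
  define K' where "K' = K - {i}"
  have K': "finite K'" "i \<notin> K'" "K = insert i K'" using K by (auto simp: K'_def)
  have F0[measurable]: "(\<lambda>x. F (x(i := 0))) \<in> borel_measurable (PiM K \<mu>)"
    by (rule measurable_compose[OF measurable_zero_coordinate[OF \<mu>(2) K(2)] F])
  note integral_insert = product_nn_integral_insert[OF K'(1,2), folded K'(3)]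
  have "(\<integral>\<^sup>+ x. ennreal (\<bar>F (x(i := 0))\<bar> powr p) \<partial>PiM K \<mu>)
      = (\<integral>\<^sup>+ x. (\<integral>\<^sup>+ y. ennreal (\<bar>F ((x(i := y))(i := 0))\<bar> powr p) \<partial>\<mu> i) \<partial>PiM K' \<mu>)"
    by (rule integral_insert) measurable
  also have "\<dots> = (\<integral>\<^sup>+ x. ennreal (\<bar>F (x(i := 0))\<bar> powr p) \<partial>PiM K' \<mu>)"
    by (simp only: fun_upd_upd nn_integral_const prob_space.emeasure_space_1[OF \<mu>(1)] mult_1_right)
  also have "\<dots> \<le> (\<integral>\<^sup>+ x. (\<integral>\<^sup>+ y. ennreal (\<bar>F (x(i := y))\<bar> powr p) \<partial>\<mu> i) \<partial>PiM K' \<mu>)"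
  proof (rule nn_integral_mono)
    fix x
    obtain a c where "F (x(i := y)) = a + c * y" for y
      using affine by (rule affine_inE[where x = x]) blast
    show "ennreal (\<bar>F (x(i := 0))\<bar> powr p) \<le> (\<integral>\<^sup>+ y. ennreal (\<bar>F (x(i := y))\<bar> powr p) \<partial>\<mu> i)"
      using abs_powr_le_centered_integral[OF \<mu>(1) p centered, of a c]
      by (simp add: \<open>\<And>y. F (x(i := y)) = a + c * y\<close>)
  qed
  also have "\<dots> = (\<integral>\<^sup>+ x. ennreal (\<bar>F x\<bar> powr p) \<partial>PiM K \<mu>)"
    by (rule integral_insert[symmetric]) measurable
  finally show ?thesis using p by (intro Lp_norm_mono) simp_all
qed

definition zero_on :: "'i set \<Rightarrow> ('i \<Rightarrow> real) \<Rightarrow> 'i \<Rightarrow> real" where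
  "zero_on Q x = (\<lambda>k. if k \<in> Q then 0 else x k)"

text \<open>
  Zeroing one coordinate keeps the function affine in every other one, so the coordinates can be
  zeroed one after the other. Measurability is part of the conclusion because the induction needs it.
\<close>
lemma Lp_norm_zero_on_le:
  fixes F :: "('i \<Rightarrow> real) \<Rightarrow> real"
  assumes p: "p \<ge> 1" and K: "finite K"
    and \<mu>: "\<And>k. prob_space (\<mu> k)" "\<And>k. sets (\<mu> k) = sets borel"
    and Q: "finite Q" "Q \<subseteq> K"
    and centered: "\<And>k. k \<in> Q \<Longrightarrow> integrable (\<mu> k) (\<lambda>y. y)" "\<And>k. k \<in> Q \<Longrightarrow> (\<integral>y. y \<partial>\<mu> k) = 0"
    and F: "F \<in> borel_measurable (PiM K \<mu>)"
    and affine: "\<And>k. k \<in> Q \<Longrightarrow> affine_in k F"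
  shows "Lp_norm (PiM K \<mu>) p (\<lambda>x. F (zero_on Q x)) \<le> Lp_norm (PiM K \<mu>) p F
    \<and> (\<lambda>x. F (zero_on Q x)) \<in> borel_measurable (PiM K \<mu>)"
  using Q centered affine
proof (induction Q rule: finite_induct)
  case empty
  then show ?case using F by (simp add: zero_on_def)
next
  case (insert k Q)
  let ?G = "\<lambda>x. F (zero_on Q x)"
  have G: "?G \<in> borel_measurable (PiM K \<mu>)" and le: "Lp_norm (PiM K \<mu>) p ?G \<le> Lp_norm (PiM K \<mu>) p F"
    using insert by auto
  have upd: "zero_on Q (x(k := y)) = (zero_on Q x)(k := y)" for x y
    using insert.hyps by (auto simp: zero_on_def fun_eq_iff)
  have eq: "F (zero_on (insert k Q) x) = ?G (x(k := 0))" for x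
    by (rule arg_cong[of _ _ F]) (auto simp: zero_on_def fun_eq_iff)
  have "(\<lambda>x. ?G (x(k := 0))) \<in> borel_measurable (PiM K \<mu>)"
    using insert.prems by (intro measurable_compose[OF measurable_zero_coordinate[OF \<mu>(2)] G]) auto
  moreover have "Lp_norm (PiM K \<mu>) p (\<lambda>x. ?G (x(k := 0))) \<le> Lp_norm (PiM K \<mu>) p ?G"
  proof (rule Lp_norm_zero_coordinate_le[OF p K _ \<mu> _ _ G])
    have "affine_in k F" by (rule insert.prems(4)) simp
    then show "affine_in k ?G" unfolding affine_in_def upd by blast
  next
    show "k \<in> K" using insert.prems(1) by simp
    show "integrable (\<mu> k) (\<lambda>y. y)" by (rule insert.prems(2)) simp
    show "(\<integral>y. y \<partial>\<mu> k) = 0" by (rule insert.prems(3)) simp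
  qed
  ultimately show ?case using le by (simp add: eq)
qed

lemma affine_in_mult_const:
  assumes "affine_in k F" "\<And>x y. G (x(k := y)) = G x"
  shows "affine_in k (\<lambda>x. G x * F x)"
  unfolding affine_in_def
proof
  fix x
  obtain a c where "F (x(k := y)) = a + c * y" for y
    using assms(1) by (rule affine_inE[where x = x]) blast
  then have "G (x(k := y)) * F (x(k := y)) = G x * a + (G x * c) * y" for y
    by (simp add: assms(2) algebra_simps)
  then show "\<exists>a c. \<forall>y. G (x(k := y)) * F (x(k := y)) = a + c * y" by blast
qed

lemma affine_in_sum:
  assumes "finite S" "\<And>s. s \<in> S \<Longrightarrow> affine_in k (F s)"
  shows "affine_in k (\<lambda>x. \<Sum>s\<in>S. F s x)"
  unfolding affine_in_def
proof
  fix x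
  from assms(2) have "\<forall>s\<in>S. \<exists>ac. \<forall>y. F s (x(k := y)) = fst ac + snd ac * y"
    unfolding affine_in_def by simp
  then obtain ac where "\<forall>s\<in>S. \<forall>y. F s (x(k := y)) = fst (ac s) + snd (ac s) * y"
    by (rule bchoice[THEN exE])
  then have "(\<Sum>s\<in>S. F s (x(k := y))) = (\<Sum>s\<in>S. fst (ac s)) + (\<Sum>s\<in>S. snd (ac s)) * y" for y
    by (simp add: sum.distrib sum_distrib_right)
  then show "\<exists>a c. \<forall>y. (\<Sum>s\<in>S. F s (x(k := y))) = a + c * y" by blast
qed

text \<open>
  A product is affine in a coordinate that only one of its factors reads.
\<close>
lemma affine_in_prod:
  assumes "finite C" "l \<in> C" "affine_in k (h l)"
    and "\<And>l' x y. l' \<in> C - {l} \<Longrightarrow> h l' (x(k := y)) = h l' x"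
  shows "affine_in k (\<lambda>x. \<Prod>l\<in>C. h l x)"
proof -
  have "(\<lambda>x. \<Prod>l\<in>C. h l x) = (\<lambda>x. (\<Prod>l'\<in>C - {l}. h l' x) * h l x)"
    using assms(1,2) by (simp add: prod.remove mult.commute)
  moreover have "affine_in k (\<lambda>x. (\<Prod>l'\<in>C - {l}. h l' x) * h l x)"
    by (intro affine_in_mult_const assms(3) prod.cong refl assms(4))
  ultimately show ?thesis by simp
qed

section \<open>Splitting the quadratic form\<close>

lemma finite_multi_idx [simp]: "finite I \<Longrightarrow> finite (multi_idx n I)"
  by (simp add: multi_idx_def finite_PiE)

lemma multi_idx_memD: "i \<in> multi_idx n I \<Longrightarrow> l \<in> I \<Longrightarrow> i l \<in> {1..n l}"
  unfolding multi_idx_def by (rule PiE_mem)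

lemma merge_in_multi_idx:
  assumes "i \<in> multi_idx n I" "j \<in> multi_idx n J"
  shows "merge I J (i, j) \<in> multi_idx n (I \<union> J)"
  using assms by (auto simp: multi_idx_def merge_def PiE_def extensional_def Pi_iff)

lemma restrict_in_multi_idx:
  assumes "m \<in> multi_idx n I" "J \<subseteq> I"
  shows "restrict m J \<in> multi_idx n J"
  using assms by (auto simp: multi_idx_def)

text \<open>
  The library's \<open>merge\<close> is a bijection from pairs of indices on disjoint position sets to
  indices on the union.
\<close>
lemma sum_multi_idx_Un:
  fixes f :: "(nat \<Rightarrow> nat) \<Rightarrow> 'b::comm_monoid_add"
  assumes "finite I" "finite J" "I \<inter> J = {}"
  shows "(\<Sum>m\<in>multi_idx n (I \<union> J). f m)
    = (\<Sum>i\<in>multi_idx n I. \<Sum>j\<in>multi_idx n J. f (merge I J (i, j)))"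
proof -
  have "(\<Sum>m\<in>multi_idx n (I \<union> J). f m)
      = (\<Sum>ij\<in>multi_idx n I \<times> multi_idx n J. f (merge I J ij))"
  proof (rule sum.reindex_bij_witness[
      where i = "merge I J" and j = "\<lambda>m. (restrict m I, restrict m J)"])
    fix ij assume ij: "ij \<in> multi_idx n I \<times> multi_idx n J"
    obtain i j where [simp]: "ij = (i, j)" by (cases ij)
    show "(restrict (merge I J ij) I, restrict (merge I J ij) J) = ij"
      using ij assms by (auto simp: multi_idx_def restrict_merge PiE_restrict)
    show "merge I J ij \<in> multi_idx n (I \<union> J)"
      using ij by (auto intro: merge_in_multi_idx)
  next
    fix m assume m: "m \<in> multi_idx n (I \<union> J)"
    then show "merge I J (restrict m I, restrict m J) = m"
      using assms by (simp add: multi_idx_def PiE_restrict)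
    show "(restrict m I, restrict m J) \<in> multi_idx n I \<times> multi_idx n J"
      using m by (auto intro: restrict_in_multi_idx)
    show "f (merge I J (restrict m I, restrict m J)) = f m"
      using \<open>merge I J (restrict m I, restrict m J) = m\<close> by simp
  qed
  also have "\<dots> = (\<Sum>i\<in>multi_idx n I. \<Sum>j\<in>multi_idx n J. f (merge I J (i, j)))"
    by (simp add: sum.cartesian_product case_prod_unfold)
  finally show ?thesis .
qed

text \<open>
  One term of the expansion, with both indices running over all modes and the diagonal modes \<open>I\<close>
  enforced by indicators. The weight \<open>w\<close> selects index pairs in the modes outside \<open>I\<close>: the constant
  weight 1 gives the terms of the upper bound, \<open>[a \<noteq> b]\<close> the terms of the expansion, and
  \<open>[a \<in> S l] [b \<notin> S l]\<close> the terms averaged in between. Separate arguments \<open>x\<close> and \<open>y\<close> allow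
  the original to be paired with itself or with its copy.
\<close>
definition chaos_term ::
  "nat \<Rightarrow> (nat \<Rightarrow> nat) \<Rightarrow> ((nat \<Rightarrow> nat) \<Rightarrow> real) \<Rightarrow> nat set \<Rightarrow> nat set
     \<Rightarrow> (nat \<Rightarrow> nat \<Rightarrow> nat \<Rightarrow> real) \<Rightarrow> (nat \<Rightarrow> nat \<Rightarrow> real) \<Rightarrow> (nat \<Rightarrow> nat \<Rightarrow> real) \<Rightarrow> real" where
  "chaos_term d n A I J w x y =
     (\<Sum>i\<in>multi_idx n {1..d}. \<Sum>i'\<in>multi_idx n {1..d}.
        A (dot_plus d i i') * (\<Prod>l\<in>I. of_bool (i l = i' l)) * (\<Prod>l\<in>J. (x l (i l))\<^sup>2 - 1)
          * (\<Prod>l\<in>{1..d} - I. w l (i l) (i' l) * (x l (i l) * y l (i' l))))"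

text \<open>
  Only the products \<open>w l a b * (x l a * y l b)\<close> matter outside \<open>I\<close>, so entries to which the weight
  gives the value zero may be changed freely.
\<close>
lemma chaos_term_cong:
  assumes "J \<subseteq> {1..d}"
    and square: "\<And>l j. l \<in> J \<Longrightarrow> j \<in> {1..n l} \<Longrightarrow> x l j = x' l j"
    and pair: "\<And>l a b. l \<in> {1..d} - I \<Longrightarrow> a \<in> {1..n l} \<Longrightarrow> b \<in> {1..n l} \<Longrightarrow>
      w l a b * (x l a * y l b) = w' l a b * (x' l a * y' l b)"
  shows "chaos_term d n A I J w x y = chaos_term d n A I J w' x' y'"
  unfolding chaos_term_def
proof (rule sum.cong[OF refl], rule sum.cong[OF refl])
  fix i i' assume i: "i \<in> multi_idx n {1..d}" "i' \<in> multi_idx n {1..d}"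
  have mem: "i l \<in> {1..n l}" "i' l \<in> {1..n l}" if "l \<in> {1..d}" for l
    using that multi_idx_memD i by auto
  have "(\<Prod>l\<in>J. (x l (i l))\<^sup>2 - 1) = (\<Prod>l\<in>J. (x' l (i l))\<^sup>2 - 1)"
    using assms(1) mem by (intro prod.cong refl) (subst square, auto)
  moreover have "(\<Prod>l\<in>{1..d} - I. w l (i l) (i' l) * (x l (i l) * y l (i' l)))
      = (\<Prod>l\<in>{1..d} - I. w' l (i l) (i' l) * (x' l (i l) * y' l (i' l)))"
    using mem by (intro prod.cong refl pair) auto
  ultimately show "A (dot_plus d i i') * (\<Prod>l\<in>I. of_bool (i l = i' l)) * (\<Prod>l\<in>J. (x l (i l))\<^sup>2 - 1)
        * (\<Prod>l\<in>{1..d} - I. w l (i l) (i' l) * (x l (i l) * y l (i' l)))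
      = A (dot_plus d i i') * (\<Prod>l\<in>I. of_bool (i l = i' l)) * (\<Prod>l\<in>J. (x' l (i l))\<^sup>2 - 1)
        * (\<Prod>l\<in>{1..d} - I. w' l (i l) (i' l) * (x' l (i l) * y' l (i' l)))"
    by simp
qed

text \<open>
  The indicators force the two indices to agree on \<open>I\<close>. A pair of indices thus
  amounts to one common part on \<open>I\<close>, itself split along \<open>J\<close> and \<open>I - J\<close>, and two free parts
  on the complement of \<open>I\<close>.
\<close>
lemma chaos_term_collapse:
  assumes "J \<subseteq> I" "I \<subseteq> {1..d}"
  shows "chaos_term d n A I J (\<lambda>_ _ _. 1) x y =
     (\<Sum>i\<in>multi_idx n J. \<Sum>j\<in>multi_idx n (I - J).
      \<Sum>k\<in>multi_idx n ({1..d} - I). \<Sum>k'\<in>multi_idx n ({1..d} - I).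
        A (dot_plus d
             (merge I ({1..d} - I) (merge J (I - J) (i, j), k))
             (merge I ({1..d} - I) (merge J (I - J) (i, j), k')))
        * (\<Prod>l\<in>J. (x l (i l))\<^sup>2 - 1)
        * (\<Prod>l\<in>{1..d} - I. x l (k l) * y l (k' l)))"
proof -
  let ?C = "{1..d} - I"
  have fin: "finite I" "finite J" "finite ?C" "finite (I - J)"
    using assms by (meson finite_Diff finite_atLeastAtMost finite_subset)+
  have disj: "I \<inter> ?C = {}" "J \<inter> (I - J) = {}" by auto
  have un: "{1..d} = I \<union> ?C" "I = J \<union> (I - J)" using assms by auto
  define g where "g i i' = A (dot_plus d i i') * (\<Prod>l\<in>J. (x l (i l))\<^sup>2 - 1)
          * (\<Prod>l\<in>?C. x l (i l) * y l (i' l))" for i i'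
  have "chaos_term d n A I J (\<lambda>_ _ _. 1) x y
      = (\<Sum>i\<in>multi_idx n (I \<union> ?C). \<Sum>i'\<in>multi_idx n (I \<union> ?C).
          (\<Prod>l\<in>I. of_bool (i l = i' l)) * g i i')"
    unfolding chaos_term_def un(1)[symmetric] by (simp add: g_def mult_ac)
  also have "\<dots> = (\<Sum>m\<in>multi_idx n I. \<Sum>k\<in>multi_idx n ?C. \<Sum>m'\<in>multi_idx n I. \<Sum>k'\<in>multi_idx n ?C.
      of_bool (m = m') * g (merge I ?C (m, k)) (merge I ?C (m', k')))"
  proof -
    have "(\<Prod>l\<in>I. of_bool (merge I ?C (m, k) l = merge I ?C (m', k') l)) = (of_bool (m = m') :: real)"
      if "m \<in> multi_idx n I" "m' \<in> multi_idx n I" for m m' k k'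
    proof -
      have "(\<Prod>l\<in>I. of_bool (merge I ?C (m, k) l = merge I ?C (m', k') l)) = (\<Prod>l\<in>I. of_bool (m l = m' l) :: real)"
        by (intro prod.cong) (auto simp: merge_def)
      also have "\<dots> = of_bool (m = m')"
      proof (cases "m = m'")
        case False
        moreover have "m = m'" if "\<And>l. l \<in> I \<Longrightarrow> m l = m' l"
          using \<open>m \<in> multi_idx n I\<close> \<open>m' \<in> multi_idx n I\<close> that
          unfolding multi_idx_def by (rule PiE_ext)
        ultimately obtain l where "l \<in> I" "m l \<noteq> m' l" by auto
        then show ?thesis using fin(1) False by (auto intro!: prod_zero)
      qed simp
      finally show ?thesis .
    qed
    then show ?thesis
      unfolding sum_multi_idx_Un[OF fin(1,3) disj(1)] by (intro sum.cong refl) (simp only:)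
  qed
  also have "\<dots> = (\<Sum>m\<in>multi_idx n I. \<Sum>k\<in>multi_idx n ?C. \<Sum>k'\<in>multi_idx n ?C.
      g (merge I ?C (m, k)) (merge I ?C (m, k')))"
  proof (rule sum.cong[OF refl], rule sum.cong[OF refl])
    fix m k assume m: "m \<in> multi_idx n I"
    have "(\<Sum>m'\<in>multi_idx n I. \<Sum>k'\<in>multi_idx n ?C.
        of_bool (m = m') * g (merge I ?C (m, k)) (merge I ?C (m', k')))
      = (\<Sum>m'\<in>multi_idx n I. if m = m' then \<Sum>k'\<in>multi_idx n ?C. g (merge I ?C (m, k)) (merge I ?C (m', k')) else 0)"
      by (intro sum.cong) auto
    also have "\<dots> = (\<Sum>k'\<in>multi_idx n ?C. g (merge I ?C (m, k)) (merge I ?C (m, k')))"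
      using m fin by simp
    finally show "(\<Sum>m'\<in>multi_idx n I. \<Sum>k'\<in>multi_idx n ?C.
        of_bool (m = m') * g (merge I ?C (m, k)) (merge I ?C (m', k'))) = \<dots>" .
  qed
  also have "\<dots> = (\<Sum>i\<in>multi_idx n J. \<Sum>j\<in>multi_idx n (I - J).
      \<Sum>k\<in>multi_idx n ?C. \<Sum>k'\<in>multi_idx n ?C.
      g (merge I ?C (merge J (I - J) (i, j), k)) (merge I ?C (merge J (I - J) (i, j), k')))"
    by (rule sum_multi_idx_Un[OF fin(2,4) disj(2), folded un(2)])
  also have "\<dots> = (\<Sum>i\<in>multi_idx n J. \<Sum>j\<in>multi_idx n (I - J).
      \<Sum>k\<in>multi_idx n ({1..d} - I). \<Sum>k'\<in>multi_idx n ({1..d} - I).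
        A (dot_plus d
             (merge I ({1..d} - I) (merge J (I - J) (i, j), k))
             (merge I ({1..d} - I) (merge J (I - J) (i, j), k')))
        * (\<Prod>l\<in>J. (x l (i l))\<^sup>2 - 1)
        * (\<Prod>l\<in>{1..d} - I. x l (k l) * y l (k' l)))"
    unfolding g_def using assms
    by (intro sum.cong refl arg_cong2[where f = "(*)"] prod.cong) (auto simp: merge_def)
  finally show ?thesis .
qed

lemma sum_sum_swap:
  "(\<Sum>a\<in>S. \<Sum>b\<in>T. \<Sum>c\<in>P. h a b c) = (\<Sum>c\<in>P. \<Sum>a\<in>S. \<Sum>b\<in>T. h a b c)"
proof -
  have "(\<Sum>b\<in>T. \<Sum>c\<in>P. h a b c) = (\<Sum>c\<in>P. \<Sum>b\<in>T. h a b c)" for a by (rule sum.swap)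
  then show ?thesis
    using sum.swap[of "\<lambda>a c. \<Sum>b\<in>T. h a b c" P S] by simp
qed

text \<open>
  The splitting of each \<open>X\<^sub>a X\<^sub>b\<close> is expanded in two stages: choosing the diagonal modes gives \<open>I\<close>,
  and choosing the summand \<open>X\<^sub>a\<^sup>2 - 1\<close> in \<open>(X\<^sub>a\<^sup>2 - 1) + 1\<close> gives \<open>J\<close>.
\<close>
lemma sum_chaos_terms:
  "(\<Sum>i\<in>multi_idx n {1..d}. \<Sum>i'\<in>multi_idx n {1..d}.
      A (dot_plus d i i') * (\<Prod>l\<in>{1..d}. x l (i l) * x l (i' l)))
   = (\<Sum>I\<in>Pow {1..d}. \<Sum>J\<in>Pow I. chaos_term d n A I J (\<lambda>_ a b. of_bool (a \<noteq> b)) x x)"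
proof -
  have split: "(\<Prod>l\<in>{1..d}. x l (i l) * x l (i' l))
      = (\<Sum>I\<in>Pow {1..d}. \<Sum>J\<in>Pow I. (\<Prod>l\<in>I. of_bool (i l = i' l)) * (\<Prod>l\<in>J. (x l (i l))\<^sup>2 - 1)
          * (\<Prod>l\<in>{1..d} - I. of_bool (i l \<noteq> i' l) * (x l (i l) * x l (i' l))))" for i i'
  proof -
    have "(\<Prod>l\<in>{1..d}. x l (i l) * x l (i' l))
        = (\<Prod>l\<in>{1..d}. of_bool (i l = i' l) * ((x l (i l))\<^sup>2 - 1 + 1)
            + of_bool (i l \<noteq> i' l) * (x l (i l) * x l (i' l)))"
      by (intro prod.cong) (auto simp: power2_eq_square)
    also have "\<dots> = (\<Sum>I\<in>Pow {1..d}. (\<Prod>l\<in>I. of_bool (i l = i' l) * ((x l (i l))\<^sup>2 - 1 + 1))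
          * (\<Prod>l\<in>{1..d} - I. of_bool (i l \<noteq> i' l) * (x l (i l) * x l (i' l))))"
      by (rule prod_add) simp
    also have "\<dots> = (\<Sum>I\<in>Pow {1..d}. \<Sum>J\<in>Pow I. (\<Prod>l\<in>I. of_bool (i l = i' l)) * (\<Prod>l\<in>J. (x l (i l))\<^sup>2 - 1)
          * (\<Prod>l\<in>{1..d} - I. of_bool (i l \<noteq> i' l) * (x l (i l) * x l (i' l))))"
    proof (intro sum.cong refl)
      fix I assume "I \<in> Pow {1..d}"
      then have "finite I" by (auto intro: finite_subset)
      then have "(\<Prod>l\<in>I. (x l (i l))\<^sup>2 - 1 + 1) = (\<Sum>J\<in>Pow I. \<Prod>l\<in>J. (x l (i l))\<^sup>2 - 1)"
        by (subst prod_add) auto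
      then show "(\<Prod>l\<in>I. of_bool (i l = i' l) * ((x l (i l))\<^sup>2 - 1 + 1))
          * (\<Prod>l\<in>{1..d} - I. of_bool (i l \<noteq> i' l) * (x l (i l) * x l (i' l)))
        = (\<Sum>J\<in>Pow I. (\<Prod>l\<in>I. of_bool (i l = i' l)) * (\<Prod>l\<in>J. (x l (i l))\<^sup>2 - 1)
          * (\<Prod>l\<in>{1..d} - I. of_bool (i l \<noteq> i' l) * (x l (i l) * x l (i' l))))"
        by (simp only: prod.distrib sum_distrib_left sum_distrib_right)
    qed
    finally show ?thesis .
  qed
  show ?thesis
    unfolding split sum_distrib_left chaos_term_def sum_sum_swap[where P = "Pow {1..d}"]
  proof (rule sum.cong)
    fix I
    show "(\<Sum>i\<in>multi_idx n {1..d}. \<Sum>i'\<in>multi_idx n {1..d}. \<Sum>J\<in>Pow I. A (dot_plus d i i') *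
            ((\<Prod>l\<in>I. of_bool (i l = i' l)) * (\<Prod>l\<in>J. (x l (i l))\<^sup>2 - 1)
              * (\<Prod>l\<in>{1..d} - I. of_bool (i l \<noteq> i' l) * (x l (i l) * x l (i' l)))))
        = (\<Sum>J\<in>Pow I. \<Sum>i\<in>multi_idx n {1..d}. \<Sum>i'\<in>multi_idx n {1..d}. A (dot_plus d i i') *
            (\<Prod>l\<in>I. of_bool (i l = i' l)) * (\<Prod>l\<in>J. (x l (i l))\<^sup>2 - 1)
              * (\<Prod>l\<in>{1..d} - I. of_bool (i l \<noteq> i' l) * (x l (i l) * x l (i' l))))"
      unfolding mult.assoc by (rule sum_sum_swap)
  qed simp
qed

section \<open>Averaging over index sets\<close>

text \<open>
  For \<open>a \<noteq> b\<close>, a subset of \<open>S\<close> containing \<open>a\<close> but not \<open>b\<close> is determined by its intersection with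
  the other \<open>card S - 2\<close> points, so a quarter of all subsets qualify.
\<close>
lemma sum_Pow_separating:
  assumes "a \<in> S" "b \<in> S" "finite S"
  shows "4 / 2 ^ card S * (\<Sum>T\<in>Pow S. of_bool (a \<in> T) * of_bool (b \<notin> T)) = (of_bool (a \<noteq> b) :: real)"
proof (cases "a = b")
  case False
  have "(\<Sum>T\<in>Pow S. of_bool (a \<in> T) * of_bool (b \<notin> T)) = (\<Sum>T\<in>insert a ` Pow (S - {a, b}). (1::real))"
  proof (intro sum.mono_neutral_cong_right)
    show "\<forall>T\<in>Pow S - insert a ` Pow (S - {a, b}). of_bool (a \<in> T) * of_bool (b \<notin> T) = (0::real)"
    proof
      fix T assume T: "T \<in> Pow S - insert a ` Pow (S - {a, b})"
      show "of_bool (a \<in> T) * of_bool (b \<notin> T) = (0::real)"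
      proof (rule ccontr)
        assume "\<not> ?thesis"
        then have "a \<in> T" "b \<notin> T" by (auto split: if_splits)
        then have "T = insert a (T - {a})" "T - {a} \<in> Pow (S - {a, b})" using T by auto
        then show False using T by blast
      qed
    qed
  qed (use assms False in auto)
  also have "\<dots> = real (card (Pow (S - {a, b})))"
    by (subst sum.reindex) (auto simp: inj_on_def)
  also have "\<dots> = 2 ^ card (S - {a, b})"
    using assms by (simp add: card_Pow)
  finally have "(\<Sum>T\<in>Pow S. of_bool (a \<in> T) * of_bool (b \<notin> T)) = (2::real) ^ card (S - {a, b})" .
  moreover have "card S = card (S - {a, b}) + 2"
    using assms False card_mono[of S "{a,b}"] by (subst card_Diff_subset) auto
  ultimately show ?thesis using False by (simp add: power_add)
qed (auto intro!: sum.neutral)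

text \<open>
  The sets are chosen independently in the modes outside \<open>I\<close>: a product over these modes of averages over
  subsets is an average over families of subsets.
\<close>
lemma chaos_term_offdiag_avg:
  assumes "I \<subseteq> {1..d}"
  shows "chaos_term d n A I J (\<lambda>_ a b. of_bool (a \<noteq> b)) x y =
    (\<Sum>S\<in>(\<Pi>\<^sub>E l\<in>{1..d} - I. Pow {1..n l}).
       (4 ^ (d - card I) / (\<Prod>l\<in>{1..d} - I. 2 ^ n l)) *
       chaos_term d n A I J (\<lambda>l a b. of_bool (a \<in> S l) * of_bool (b \<notin> S l)) x y)"
proof -
  let ?C = "{1..d} - I" and ?P = "\<Pi>\<^sub>E l\<in>{1..d} - I. Pow {1..n l}"
  define \<kappa> :: real where "\<kappa> = 4 ^ (d - card I) / (\<Prod>l\<in>?C. 2 ^ n l)"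
  have \<kappa>: "\<kappa> = (\<Prod>l\<in>?C. 4 / 2 ^ n l)"
    using assms by (simp add: \<kappa>_def prod_dividef card_Diff_subset finite_subset)
  have "(\<Prod>l\<in>?C. of_bool (i l \<noteq> i' l) * (x l (i l) * y l (i' l)))
      = (\<Sum>S\<in>?P. \<kappa> * (\<Prod>l\<in>?C. of_bool (i l \<in> S l) * of_bool (i' l \<notin> S l) * (x l (i l) * y l (i' l))))"
    if "i \<in> multi_idx n {1..d}" "i' \<in> multi_idx n {1..d}" for i i'
  proof -
    have "(\<Prod>l\<in>?C. of_bool (i l \<noteq> i' l) * (x l (i l) * y l (i' l)))
        = (\<Prod>l\<in>?C. 4 / 2 ^ n l * (\<Sum>T\<in>Pow {1..n l}. of_bool (i l \<in> T) * of_bool (i' l \<notin> T) * (x l (i l) * y l (i' l))))"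
    proof (intro prod.cong refl)
      fix l assume "l \<in> ?C"
      then have "i l \<in> {1..n l}" "i' l \<in> {1..n l}" using that by (auto simp: multi_idx_def PiE_iff)
      then have "of_bool (i l \<noteq> i' l)
          = (4 / 2 ^ n l * (\<Sum>T\<in>Pow {1..n l}. of_bool (i l \<in> T) * of_bool (i' l \<notin> T)) :: real)"
        using sum_Pow_separating[of "i l" "{1..n l}" "i' l"] by (simp only: finite_atLeastAtMost card_atLeastAtMost diff_Suc_1)
      then
      show "of_bool (i l \<noteq> i' l) * (x l (i l) * y l (i' l))
        = 4 / 2 ^ n l * (\<Sum>T\<in>Pow {1..n l}. of_bool (i l \<in> T) * of_bool (i' l \<notin> T) * (x l (i l) * y l (i' l)))"
        by (simp only: sum_distrib_right[symmetric] mult.assoc[symmetric])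
    qed
    also have "\<dots> = \<kappa> * (\<Prod>l\<in>?C. \<Sum>T\<in>Pow {1..n l}. of_bool (i l \<in> T) * of_bool (i' l \<notin> T) * (x l (i l) * y l (i' l)))"
      by (simp only: \<kappa> prod.distrib)
    also have "\<dots> = \<kappa> * (\<Sum>S\<in>?P. \<Prod>l\<in>?C. of_bool (i l \<in> S l) * of_bool (i' l \<notin> S l) * (x l (i l) * y l (i' l)))"
      by (subst prod_sum_PiE) auto
    finally show ?thesis by (simp add: sum_distrib_left)
  qed
  note expand = this
  show ?thesis
    unfolding chaos_term_def \<kappa>_def[symmetric] sum_distrib_left sum_sum_swap[where P = ?P, symmetric]
  proof (intro sum.cong refl)
    fix i i' assume ii: "i \<in> multi_idx n {1..d}" "i' \<in> multi_idx n {1..d}"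
    show "A (dot_plus d i i') * (\<Prod>l\<in>I. of_bool (i l = i' l)) * (\<Prod>l\<in>J. (x l (i l))\<^sup>2 - 1)
        * (\<Prod>l\<in>?C. of_bool (i l \<noteq> i' l) * (x l (i l) * y l (i' l)))
      = (\<Sum>S\<in>?P. \<kappa> * (A (dot_plus d i i') * (\<Prod>l\<in>I. of_bool (i l = i' l)) * (\<Prod>l\<in>J. (x l (i l))\<^sup>2 - 1)
        * (\<Prod>l\<in>?C. of_bool (i l \<in> S l) * of_bool (i' l \<notin> S l) * (x l (i l) * y l (i' l)))))"
      unfolding expand[OF ii] sum_distrib_left by (rule sum.cong[OF refl], rule mult.left_commute)
  qed
qed

section \<open>Decoupling on the product space\<close>

text \<open>
  The entries of all vectors as one family of coordinates: \<open>Inl l\<close> marks the vector \<open>X l\<close>, and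
  \<open>Inr l\<close> its copy.
\<close>
definition coords :: "nat \<Rightarrow> (nat \<Rightarrow> nat) \<Rightarrow> ((nat + nat) \<times> nat) set" where
  "coords d n = (SIGMA c:{1..d} <+> {1..d}. {1..case_sum n n c})"

abbreviation original :: "((nat + nat) \<times> nat \<Rightarrow> real) \<Rightarrow> nat \<Rightarrow> nat \<Rightarrow> real" where
  "original x \<equiv> \<lambda>l j. x (Inl l, j)"

abbreviation copy :: "((nat + nat) \<times> nat \<Rightarrow> real) \<Rightarrow> nat \<Rightarrow> nat \<Rightarrow> real" where
  "copy x \<equiv> \<lambda>l j. x (Inr l, j)"

lemma finite_coords [simp]: "finite (coords d n)"
  by (auto simp: coords_def intro!: finite_SigmaI split: sum.split)

lemma coords_iff [simp]:
  "(Inl l, j) \<in> coords d n \<longleftrightarrow> l \<in> {1..d} \<and> j \<in> {1..n l}"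
  "(Inr l, j) \<in> coords d n \<longleftrightarrow> l \<in> {1..d} \<and> j \<in> {1..n l}"
  by (auto simp: coords_def)

lemma chaos_term_measurable:
  assumes "J \<subseteq> {1..d}"
    and "\<And>l j. l \<in> {1..d} \<Longrightarrow> j \<in> {1..n l} \<Longrightarrow> (\<lambda>\<omega>. x \<omega> l j) \<in> borel_measurable N"
    and "\<And>l j. l \<in> {1..d} \<Longrightarrow> j \<in> {1..n l} \<Longrightarrow> (\<lambda>\<omega>. y \<omega> l j) \<in> borel_measurable N"
  shows "(\<lambda>\<omega>. chaos_term d n A I J w (x \<omega>) (y \<omega>)) \<in> borel_measurable N"
  unfolding chaos_term_def
proof (intro borel_measurable_sum borel_measurable_times borel_measurable_prod borel_measurable_const
    borel_measurable_diff borel_measurable_power)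
  fix i i' l assume i: "i \<in> multi_idx n {1..d}" "i' \<in> multi_idx n {1..d}"
  show "(\<lambda>\<omega>. x \<omega> l (i l)) \<in> borel_measurable N" if "l \<in> J"
    using assms(1) i that by (intro assms(2) multi_idx_memD[OF i(1)]) auto
  assume l: "l \<in> {1..d} - I"
  show "(\<lambda>\<omega>. x \<omega> l (i l)) \<in> borel_measurable N"
    using l by (intro assms(2) multi_idx_memD[OF i(1)]) auto
  show "(\<lambda>\<omega>. y \<omega> l (i' l)) \<in> borel_measurable N"
    using l by (intro assms(3) multi_idx_memD[OF i(2)]) auto
qed

text \<open>
  In a mode outside \<open>I\<close>, every summand contains one original entry and one copied entry, which are
  different coordinates. Modes in \<open>J\<close> contain squares, but they lie in \<open>I\<close>.
\<close>
lemma chaos_term_affine: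
  assumes "J \<subseteq> I" "l \<in> {1..d} - I" "k = (Inl l, j) \<or> k = (Inr l, j)"
  shows "affine_in k (\<lambda>x. chaos_term d n A I J w (original x) (copy x))"
  unfolding chaos_term_def
proof (rule affine_in_sum, simp, rule affine_in_sum, simp, rule affine_in_mult_const,
    rule affine_in_prod[where l = l])
  fix i i'
  show "affine_in k (\<lambda>x. w l (i l) (i' l) * (x (Inl l, i l) * x (Inr l, i' l)))"
  proof (rule affine_in_mult_const)
    show "affine_in k (\<lambda>x. x (Inl l, i l) * x (Inr l, i' l))"
      unfolding affine_in_def
    proof
      fix x :: "(nat + nat) \<times> nat \<Rightarrow> real"
      show "\<exists>a c. \<forall>y. (x(k := y)) (Inl l, i l) * (x(k := y)) (Inr l, i' l) = a + c * y"
        using assms(3)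
        by (intro exI[of _ "if k = (Inl l, i l) \<or> k = (Inr l, i' l) then 0 else x (Inl l, i l) * x (Inr l, i' l)"]
              exI[of _ "(if k = (Inl l, i l) then x (Inr l, i' l) else 0)
              + (if k = (Inr l, i' l) then x (Inl l, i l) else 0)"]) auto
    qed
  qed simp
next
  fix i i' l' x y assume l': "l' \<in> {1..d} - I - {l}"
  show "w l' (i l') (i' l') * ((x(k := y)) (Inl l', i l') * (x(k := y)) (Inr l', i' l'))
      = w l' (i l') (i' l') * (x (Inl l', i l') * x (Inr l', i' l'))"
    using assms(3) l' by auto
next
  fix i i' :: "nat \<Rightarrow> nat" and x y
  have "(\<Prod>l\<in>J. ((x(k := y)) (Inl l, i l))\<^sup>2 - 1) = (\<Prod>l\<in>J. (x (Inl l, i l))\<^sup>2 - (1::real))"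
    using assms by (intro prod.cong) auto
  then show "A (dot_plus d i i') * (\<Prod>l\<in>I. of_bool (i l = i' l)) * (\<Prod>l\<in>J. ((x(k := y)) (Inl l, i l))\<^sup>2 - 1)
    = A (dot_plus d i i') * (\<Prod>l\<in>I. of_bool (i l = i' l)) * (\<Prod>l\<in>J. (x (Inl l, i l))\<^sup>2 - 1)" by simp
qed (use assms in auto)

abbreviation separated :: "(nat \<Rightarrow> nat set) \<Rightarrow> nat \<Rightarrow> nat \<Rightarrow> nat \<Rightarrow> real" where
  "separated S \<equiv> \<lambda>l a b. of_bool (a \<in> S l) * of_bool (b \<notin> S l)"

text \<open>
  Exchanges originals and copies at the entries of modes in \<open>C\<close> that \<open>separated S\<close> allows for the second factor.
\<close>
definition swap_outside :: "nat set \<Rightarrow> (nat \<Rightarrow> nat set) \<Rightarrow> (nat + nat) \<times> nat \<Rightarrow> (nat + nat) \<times> nat" where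
  "swap_outside C S k = (case k of
      (Inl l, j) \<Rightarrow> (if l \<in> C \<and> j \<notin> S l then Inr l else Inl l, j)
    | (Inr l, j) \<Rightarrow> (if l \<in> C \<and> j \<notin> S l then Inl l else Inr l, j))"

lemma swap_outside_involution: "swap_outside C S (swap_outside C S k) = k"
  by (auto simp: swap_outside_def split: prod.splits sum.splits)

text \<open>
  The coordinates of modes in \<open>C\<close> that a product \<open>x\<^sub>a y\<^sub>b\<close> with \<open>a \<in> S l\<close>, \<open>b \<notin> S l\<close> never reads.
  Setting them to zero leaves exactly these products.
\<close>
definition complementary_coords ::
  "nat \<Rightarrow> (nat \<Rightarrow> nat) \<Rightarrow> nat set \<Rightarrow> (nat \<Rightarrow> nat set) \<Rightarrow> ((nat + nat) \<times> nat) set" where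
  "complementary_coords d n C S =
     {k \<in> coords d n. case k of (Inl l, j) \<Rightarrow> l \<in> C \<and> j \<notin> S l | (Inr l, j) \<Rightarrow> l \<in> C \<and> j \<in> S l}"

text \<open>
  The joint law of independent centred real entries together with independent copies: a product measure in
  which a copied coordinate has the same factor as its original.
\<close>
locale copied_product =
  fixes d :: nat and n :: "nat \<Rightarrow> nat" and \<mu> :: "(nat + nat) \<times> nat \<Rightarrow> real measure" and p :: real
  assumes prob_factor: "\<And>k. prob_space (\<mu> k)"
    and sets_factor: "\<And>k. sets (\<mu> k) = sets borel"
    and factor_copy: "\<And>l j. \<mu> (Inr l, j) = \<mu> (Inl l, j)"
    and integrable_factor: "\<And>k. k \<in> coords d n \<Longrightarrow> integrable (\<mu> k) (\<lambda>y. y)"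
    and mean_factor: "\<And>k. k \<in> coords d n \<Longrightarrow> (\<integral>y. y \<partial>\<mu> k) = 0"
    and p_ge_1: "p \<ge> 1"
begin

abbreviation P :: "((nat + nat) \<times> nat \<Rightarrow> real) measure" where
  "P \<equiv> PiM (coords d n) \<mu>"

lemma coordinate_measurable:
  assumes "k \<in> coords d n"
  shows "(\<lambda>x. x k) \<in> borel_measurable P"
proof -
  have "(\<lambda>x. x k) \<in> measurable P (\<mu> k)" using assms by (rule measurable_component_singleton)
  then show ?thesis using sets_factor[of k] by (simp cong: measurable_cong_sets)
qed

lemma chaos_measurable:
  assumes "J \<subseteq> {1..d}"
  shows "(\<lambda>x. chaos_term d n A I J w (original x) (copy x)) \<in> borel_measurable P"
    and "(\<lambda>x. chaos_term d n A I J w (original x) (original x)) \<in> borel_measurable P"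
  using assms by (auto intro!: chaos_term_measurable coordinate_measurable)

text \<open>
  The exchange of coordinates preserves the product measure. Under \<open>separated S\<close> the first factor only
  reads originals that stay in place and the second factor only entries that are exchanged; the
  squares belong to modes in which nothing is exchanged.
\<close>
lemma swap_original_copy:
  assumes "J \<subseteq> I" "I \<subseteq> {1..d}"
  shows "Lp_norm P p (\<lambda>x. chaos_term d n A I J (separated S) (original x) (original x))
    = Lp_norm P p (\<lambda>x. chaos_term d n A I J (separated S) (original x) (copy x))"
proof -
  define \<tau> where "\<tau> = swap_outside ({1..d} - I) S"
  define T where "T x = (\<lambda>k\<in>coords d n. x (\<tau> k))" for x :: "(nat + nat) \<times> nat \<Rightarrow> real"
  have \<tau>: "inj_on \<tau> (coords d n)" "\<tau> \<in> coords d n \<rightarrow> coords d n"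
    unfolding \<tau>_def using swap_outside_involution
    by (rule inj_on_inverseI) (auto simp: swap_outside_def split: sum.splits)
  have \<mu>\<tau>: "(\<lambda>k. \<mu> (\<tau> k)) = \<mu>"
    by (auto simp: fun_eq_iff \<tau>_def swap_outside_def factor_copy split: prod.splits sum.splits)
  have invariant: "distr P P T = P"
    using distr_PiM_reindex[of _ \<mu>, OF prob_factor \<tau>] unfolding \<mu>\<tau> T_def .
  have "T \<in> measurable P P"
    unfolding T_def
  proof (rule measurable_restrict)
    fix k assume "k \<in> coords d n"
    then have "\<tau> k \<in> coords d n" using \<tau>(2) by (rule funcset_mem[rotated])
    then have "(\<lambda>x. x (\<tau> k)) \<in> measurable P (\<mu> (\<tau> k))" by (rule measurable_component_singleton)
    then show "(\<lambda>x. x (\<tau> k)) \<in> measurable P (\<mu> k)" by (simp only: fun_cong[OF \<mu>\<tau>])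
  qed
  then have "Lp_norm (distr P P T) p (\<lambda>x. chaos_term d n A I J (separated S) (original x) (copy x))
      = Lp_norm P p (\<lambda>x. chaos_term d n A I J (separated S) (original (T x)) (copy (T x)))"
    using assms by (intro Lp_norm_distr chaos_measurable) auto
  moreover have "chaos_term d n A I J (separated S) (original (T x)) (copy (T x))
      = chaos_term d n A I J (separated S) (original x) (original x)" for x
  proof (rule chaos_term_cong)
    fix l j assume "l \<in> J" "j \<in> {1..n l}"
    then show "T x (Inl l, j) = x (Inl l, j)"
      using assms by (auto simp: T_def \<tau>_def swap_outside_def)
  next
    fix l a b assume "l \<in> {1..d} - I" "a \<in> {1..n l}" "b \<in> {1..n l}"
    then show "separated S l a b * (T x (Inl l, a) * T x (Inr l, b))
        = separated S l a b * (x (Inl l, a) * x (Inl l, b))"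
      by (auto simp: T_def \<tau>_def swap_outside_def)
  qed (use assms in auto)
  ultimately show ?thesis by (simp add: invariant)
qed

text \<open>
  After decoupling, the restricted term is the full term with the complementary coordinates set to zero.
  The order of the steps matters: before decoupling, the full term contains squares of the
  coordinates and is not affine in them.
\<close>
lemma separated_chaos_decoupling:
  assumes "J \<subseteq> I" "I \<subseteq> {1..d}"
  shows "Lp_norm P p (\<lambda>x. chaos_term d n A I J (separated S) (original x) (original x))
    \<le> Lp_norm P p (\<lambda>x. chaos_term d n A I J (\<lambda>_ _ _. 1) (original x) (copy x))"
proof -
  define Q where "Q = complementary_coords d n ({1..d} - I) S"
  let ?F = "\<lambda>x. chaos_term d n A I J (\<lambda>_ _ _. 1) (original x) (copy x)"
  have Q: "finite Q" "Q \<subseteq> coords d n"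
    by (auto simp: Q_def complementary_coords_def)
  have "?F (zero_on Q x) = chaos_term d n A I J (separated S) (original x) (copy x)" for x
  proof (rule chaos_term_cong)
    fix l j assume "l \<in> J" "j \<in> {1..n l}"
    then show "zero_on Q x (Inl l, j) = x (Inl l, j)"
      using assms by (auto simp: zero_on_def Q_def complementary_coords_def)
  next
    fix l a b assume "l \<in> {1..d} - I" "a \<in> {1..n l}" "b \<in> {1..n l}"
    then show "1 * (zero_on Q x (Inl l, a) * zero_on Q x (Inr l, b))
        = separated S l a b * (x (Inl l, a) * x (Inr l, b))"
      by (auto simp: zero_on_def Q_def complementary_coords_def)
  qed (use assms in auto)
  moreover have "Lp_norm P p (\<lambda>x. ?F (zero_on Q x)) \<le> Lp_norm P p ?F"
  proof (rule conjunct1[OF Lp_norm_zero_on_le])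
    show "?F \<in> borel_measurable P" using assms by (intro chaos_measurable) auto
    fix k assume k: "k \<in> Q"
    obtain c j where kk: "k = (c, j)" by (cases k)
    show "affine_in k ?F"
    proof (cases c)
      case (Inl l)
      with k kk show ?thesis
        by (intro chaos_term_affine[OF assms(1), of l _ k j]) (auto simp: Q_def complementary_coords_def)
    next
      case (Inr l)
      with k kk show ?thesis
        by (intro chaos_term_affine[OF assms(1), of l _ k j]) (auto simp: Q_def complementary_coords_def)
    qed
  next
    fix k assume "k \<in> Q"
    then have "k \<in> coords d n" using Q(2) by blast
    then show "integrable (\<mu> k) (\<lambda>y. y)" "(\<integral>y. y \<partial>\<mu> k) = 0"
      by (rule integrable_factor, rule mean_factor)
  qed (fact p_ge_1 finite_coords prob_factor sets_factor Q)+
  ultimately show ?thesis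
    using swap_original_copy[OF assms] by simp
qed

text \<open>
  The average runs over \<open>\<Prod>l\<in>{1..d} - I. 2 ^ n l\<close> families of sets, and
  \<open>separated_chaos_decoupling\<close> bounds each of them by the same quantity.
\<close>
lemma offdiag_chaos_decoupling:
  assumes "J \<subseteq> I" "I \<subseteq> {1..d}"
  shows "Lp_norm P p (\<lambda>x. chaos_term d n A I J (\<lambda>_ a b. of_bool (a \<noteq> b)) (original x) (original x))
    \<le> 4 ^ (d - card I) * Lp_norm P p (\<lambda>x. chaos_term d n A I J (\<lambda>_ _ _. 1) (original x) (copy x))"
proof -
  let ?S = "\<Pi>\<^sub>E l\<in>{1..d} - I. Pow {1..n l}"
  let ?B = "Lp_norm P p (\<lambda>x. chaos_term d n A I J (\<lambda>_ _ _. 1) (original x) (copy x))"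
  define \<kappa> :: real where "\<kappa> = 4 ^ (d - card I) / (\<Prod>l\<in>{1..d} - I. 2 ^ n l)"
  have \<kappa>: "\<kappa> \<ge> 0" by (simp add: \<kappa>_def prod_nonneg)
  have J: "J \<subseteq> {1..d}" using assms by auto
  have "Lp_norm P p (\<lambda>x. chaos_term d n A I J (\<lambda>_ a b. of_bool (a \<noteq> b)) (original x) (original x))
      = Lp_norm P p (\<lambda>x. \<Sum>S\<in>?S. \<kappa> * chaos_term d n A I J (separated S) (original x) (original x))"
    unfolding chaos_term_offdiag_avg[OF assms(2)] \<kappa>_def ..
  also have "\<dots> \<le> (\<Sum>S\<in>?S. Lp_norm P p (\<lambda>x. \<kappa> * chaos_term d n A I J (separated S) (original x) (original x)))"
    using J by (intro Lp_norm_sum_le p_ge_1 borel_measurable_times borel_measurable_const chaos_measurable finite_PiE) auto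
  also have "\<dots> \<le> (\<Sum>S\<in>?S. ennreal \<kappa> * ?B)"
  proof (rule sum_mono)
    fix S
    have "Lp_norm P p (\<lambda>x. \<kappa> * chaos_term d n A I J (separated S) (original x) (original x))
        \<le> ennreal \<bar>\<kappa>\<bar> * Lp_norm P p (\<lambda>x. chaos_term d n A I J (separated S) (original x) (original x))"
      using p_ge_1 J by (intro Lp_norm_cmult_le chaos_measurable) auto
    also have "\<dots> \<le> ennreal \<kappa> * ?B"
      using \<kappa> separated_chaos_decoupling[OF assms] by (auto intro: mult_left_mono)
    finally show "Lp_norm P p (\<lambda>x. \<kappa> * chaos_term d n A I J (separated S) (original x) (original x))
        \<le> ennreal \<kappa> * ?B" .
  qed
  also have "\<dots> = ennreal (real (card ?S) * \<kappa>) * ?B"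
    using \<kappa> by (simp add: ennreal_mult ennreal_of_nat_eq_real_of_nat mult_ac)
  also have "real (card ?S) * \<kappa> = 4 ^ (d - card I)"
    by (simp add: \<kappa>_def card_PiE card_Pow of_nat_prod)
  also have "ennreal (4 ^ (d - card I)) = 4 ^ (d - card I)"
    by (simp flip: ennreal_power)
  finally show ?thesis .
qed

end

section \<open>The joint law and the second moments of the entries\<close>

lemma (in prob_space) emeasure_indep_vars_box:
  assumes indep: "indep_vars N R I" and "finite I" and B: "\<And>i. i \<in> I \<Longrightarrow> B i \<in> sets (N i)"
  shows "emeasure M {\<omega> \<in> space M. \<forall>i\<in>I. R i \<omega> \<in> B i} = (\<Prod>i\<in>I. emeasure (distr M (N i) (R i)) (B i))"
proof (cases "I = {}")
  case True
  then show ?thesis by (simp add: emeasure_space_1)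
next
  case False
  have R: "R i \<in> measurable M (N i)" if "i \<in> I" for i
    using indep that by (auto simp: indep_vars_def)
  have "{\<omega> \<in> space M. \<forall>i\<in>I. R i \<omega> \<in> B i} = (\<Inter>i\<in>I. R i -` B i \<inter> space M)"
    using False by auto
  then have "emeasure M {\<omega> \<in> space M. \<forall>i\<in>I. R i \<omega> \<in> B i}
      = ennreal (\<Prod>i\<in>I. prob (R i -` B i \<inter> space M))"
    using indep_varsD_finite[OF indep False \<open>finite I\<close> B] by (simp add: emeasure_eq_measure)
  also have "\<dots> = (\<Prod>i\<in>I. emeasure M (R i -` B i \<inter> space M))"
    by (simp add: emeasure_eq_measure prod_ennreal)
  also have "\<dots> = (\<Prod>i\<in>I. emeasure (distr M (N i) (R i)) (B i))"
    using R B by (intro prod.cong refl) (simp add: emeasure_distr)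
  finally show ?thesis .
qed

text \<open>
  The given entries as a random point of the product space. It is extensional on
  \<open>coords d n\<close>, as the product space requires.
\<close>
definition sample :: "nat \<Rightarrow> (nat \<Rightarrow> nat) \<Rightarrow> (nat \<Rightarrow> nat \<Rightarrow> 'a \<Rightarrow> real) \<Rightarrow> (nat \<Rightarrow> nat \<Rightarrow> 'a \<Rightarrow> real)
    \<Rightarrow> 'a \<Rightarrow> (nat + nat) \<times> nat \<Rightarrow> real" where
  "sample d n X Xbar \<omega> =
     (\<lambda>k\<in>coords d n. case k of (c, j) \<Rightarrow> case_sum (\<lambda>l. X l j \<omega>) (\<lambda>l. Xbar l j \<omega>) c)"

text \<open>
  Originals and copies share the law of the original entry. The point mass outside \<open>coords d n\<close>
  makes every factor a probability measure.
\<close>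
definition factor_law :: "'a measure \<Rightarrow> nat \<Rightarrow> (nat \<Rightarrow> nat) \<Rightarrow> (nat \<Rightarrow> nat \<Rightarrow> 'a \<Rightarrow> real)
    \<Rightarrow> (nat + nat) \<times> nat \<Rightarrow> real measure" where
  "factor_law M d n X k =
     (if k \<in> coords d n then case k of (c, j) \<Rightarrow> distr M borel (X (case_sum id id c) j)
      else return borel 0)"

context
  fixes M :: "'a measure" and d :: nat and n :: "nat \<Rightarrow> nat"
    and X Xbar :: "nat \<Rightarrow> nat \<Rightarrow> 'a \<Rightarrow> real"
  assumes prob: "prob_space M"
    and vecs: "indep_rand_vecs M d n X"
    and entries: "\<And>l. l \<in> {1..d} \<Longrightarrow> indep_standardized_entries M (n l) (X l)"
    and copies: "corresponding_indep_copies M d n X Xbar"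
begin

interpretation prob_space M by (rule prob)

lemma entry_measurable:
  assumes "l \<in> {1..d}" "j \<in> {1..n l}"
  shows "X l j \<in> borel_measurable M"
  using entries[OF assms(1)] assms(2) by (auto simp: indep_standardized_entries_def indep_vars_def)

lemma copy_entry_measurable:
  assumes l: "l \<in> {1..d}" and j: "j \<in> {1..n l}"
  shows "Xbar l j \<in> borel_measurable M"
proof -
  have "Inr l \<in> {1..d} <+> {1..d}" using l by auto
  then have "rand_vec (n l) (Xbar l) \<in> measurable M (vec_space (n l))"
    using copies unfolding corresponding_indep_copies_def indep_vars_def by force
  then have "(\<lambda>\<omega>. rand_vec (n l) (Xbar l) \<omega> j) \<in> borel_measurable M"
    unfolding vec_space_def by (rule measurable_compose[OF _ measurable_component_singleton[OF j]])
  then show ?thesis using j by (simp add: rand_vec_def)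
qed

lemma sample_measurable: "sample d n X Xbar \<in> measurable M (PiM (coords d n) (factor_law M d n X))"
  unfolding sample_def
proof (rule measurable_restrict)
  fix k assume k: "k \<in> coords d n"
  obtain c j where kk: "k = (c, j)" by (cases k)
  show "(\<lambda>\<omega>. case k of (c, j) \<Rightarrow> case_sum (\<lambda>l. X l j \<omega>) (\<lambda>l. Xbar l j \<omega>) c) \<in> measurable M (factor_law M d n X k)"
    using k entry_measurable copy_entry_measurable
    by (cases c) (simp_all add: kk factor_law_def)
qed

text \<open>
  Within one vector, independence of the entries gives the law of the vector on boxes.
\<close>
lemma vec_box:
  assumes l: "l \<in> {1..d}" and B: "\<And>j. j \<in> {1..n l} \<Longrightarrow> B j \<in> sets borel"
  shows "emeasure (distr M (vec_space (n l)) (rand_vec (n l) (X l))) (\<Pi>\<^sub>E j\<in>{1..n l}. B j)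
    = (\<Prod>j\<in>{1..n l}. emeasure (distr M borel (X l j)) (B j))"
proof -
  have meas: "rand_vec (n l) (X l) \<in> measurable M (vec_space (n l))"
    using vecs l unfolding indep_rand_vecs_def indep_vars_def by blast
  have box: "(\<Pi>\<^sub>E j\<in>{1..n l}. B j) \<in> sets (vec_space (n l))"
    unfolding vec_space_def using B by (intro sets_PiM_I_finite) auto
  have "rand_vec (n l) (X l) -` (\<Pi>\<^sub>E j\<in>{1..n l}. B j) \<inter> space M
      = {\<omega> \<in> space M. \<forall>j\<in>{1..n l}. X l j \<omega> \<in> B j}"
    by (auto simp: rand_vec_def restrict_PiE_iff Pi_iff)
  then have "emeasure (distr M (vec_space (n l)) (rand_vec (n l) (X l))) (\<Pi>\<^sub>E j\<in>{1..n l}. B j)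
      = emeasure M {\<omega> \<in> space M. \<forall>j\<in>{1..n l}. X l j \<omega> \<in> B j}"
    using meas box by (simp add: emeasure_distr)
  also have "\<dots> = (\<Prod>j\<in>{1..n l}. emeasure (distr M borel (X l j)) (B j))"
    using entries[OF l] B unfolding indep_standardized_entries_def
    by (intro emeasure_indep_vars_box) auto
  finally show ?thesis .
qed

text \<open>
  On boxes, the law factors first over the vectors and then over the entries of each vector. The
  entries of a copy are independent because the law of the copied vector is that of the original one.
\<close>
lemma distr_sample:
  "distr M (PiM (coords d n) (factor_law M d n X)) (sample d n X Xbar) = PiM (coords d n) (factor_law M d n X)"
proof -
  let ?\<mu> = "factor_law M d n X" and ?C = "{1..d} <+> {1..d}"
  let ?N = "case_sum (\<lambda>l. vec_space (n l)) (\<lambda>l. vec_space (n l))"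
  let ?R = "case_sum (\<lambda>l. rand_vec (n l) (X l)) (\<lambda>l. rand_vec (n l) (Xbar l))"
  have \<mu>: "prob_space (?\<mu> k)" for k
    using entry_measurable
    by (auto simp: factor_law_def coords_def split: prod.split intro!: prob_space_distr prob_space_return)
  interpret product_prob_space ?\<mu> by (intro product_prob_spaceI \<mu>)
  show ?thesis
  proof (rule PiM_eqI)
    fix B assume B: "\<And>k. k \<in> coords d n \<Longrightarrow> B k \<in> sets (?\<mu> k)"
    define D where "D c = (\<Pi>\<^sub>E j\<in>{1..case_sum n n c}. B (c, j))" for c
    have B': "B (c, j) \<in> sets borel" if "c \<in> ?C" "j \<in> {1..case_sum n n c}" for c j
      using B[of "(c, j)"] that by (auto simp: factor_law_def coords_def)
    have D: "D c \<in> sets (?N c)" if "c \<in> ?C" for c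
      using that B'[OF that] unfolding D_def
      by (cases c) (auto simp: vec_space_def intro!: sets_PiM_I_finite)
    have "sample d n X Xbar -` (PiE (coords d n) B) \<inter> space M = {\<omega> \<in> space M. \<forall>c\<in>?C. ?R c \<omega> \<in> D c}"
    proof -
      have Ball_Sigma: "(\<forall>k\<in>Sigma C N. Q k) \<longleftrightarrow> (\<forall>c\<in>C. \<forall>j\<in>N c. Q (c, j))"
        for C and N :: "nat + nat \<Rightarrow> nat set" and Q by auto
      have R: "?R c \<omega> \<in> D c \<longleftrightarrow> (\<forall>j\<in>{1..case_sum n n c}.
          case_sum (\<lambda>l. X l j \<omega>) (\<lambda>l. Xbar l j \<omega>) c \<in> B (c, j))" for c \<omega>
        by (cases c) (simp_all only: D_def rand_vec_def restrict_PiE_iff sum.case)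
      have "sample d n X Xbar \<omega> \<in> PiE (coords d n) B \<longleftrightarrow> (\<forall>c\<in>?C. ?R c \<omega> \<in> D c)" for \<omega>
        unfolding sample_def restrict_PiE_iff R coords_def by (simp only: Ball_Sigma prod.case)
      then show ?thesis by auto
    qed
    moreover have "PiE (coords d n) B \<in> sets (PiM (coords d n) ?\<mu>)"
      using B by (intro sets_PiM_I_finite) auto
    ultimately have "emeasure (distr M (PiM (coords d n) ?\<mu>) (sample d n X Xbar)) (PiE (coords d n) B)
        = emeasure M {\<omega> \<in> space M. \<forall>c\<in>?C. ?R c \<omega> \<in> D c}"
      using sample_measurable by (simp add: emeasure_distr)
    also have "\<dots> = (\<Prod>c\<in>?C. emeasure (distr M (?N c) (?R c)) (D c))"
      using copies D unfolding corresponding_indep_copies_def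
      by (intro prob_space.emeasure_indep_vars_box[OF prob]) auto
    also have "\<dots> = (\<Prod>c\<in>?C. \<Prod>j\<in>{1..case_sum n n c}. emeasure (?\<mu> (c, j)) (B (c, j)))"
    proof (rule prod.cong[OF refl])
      fix c assume c: "c \<in> ?C"
      define l where "l = case_sum id id c"
      have l: "l \<in> {1..d}" "case_sum n n c = n l" using c by (auto simp: l_def)
      have "distr M (?N c) (?R c) = distr M (vec_space (n l)) (rand_vec (n l) (X l))"
        using copies c unfolding corresponding_indep_copies_def by (auto simp: l_def)
      then have "emeasure (distr M (?N c) (?R c)) (D c)
          = (\<Prod>j\<in>{1..n l}. emeasure (distr M borel (X l j)) (B (c, j)))"
        using vec_box[OF l(1), of "\<lambda>j. B (c, j)"] B'[OF c] by (simp add: D_def l(2))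
      also have "\<dots> = (\<Prod>j\<in>{1..n l}. emeasure (?\<mu> (c, j)) (B (c, j)))"
        using c l(2) by (intro prod.cong refl) (simp add: factor_law_def coords_def l_def)
      finally show "emeasure (distr M (?N c) (?R c)) (D c)
          = (\<Prod>j\<in>{1..case_sum n n c}. emeasure (?\<mu> (c, j)) (B (c, j)))"
        by (simp only: l(2))
    qed
    also have "\<dots> = (\<Prod>k\<in>coords d n. emeasure (?\<mu> k) (B k))"
      unfolding coords_def by (subst prod.Sigma) (auto split: sum.split)
    finally show "emeasure (distr M (PiM (coords d n) ?\<mu>) (sample d n X Xbar)) (PiE (coords d n) B)
        = (\<Prod>k\<in>coords d n. emeasure (?\<mu> k) (B k))" .
  qed simp_all
qed

text \<open>
  A variance of 1 implies square integrability, because the integral of a non-integrable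
  function is 0.
\<close>
lemma entry_product_moment:
  assumes l: "l \<in> {1..d}" and ab: "a \<in> {1..n l}" "b \<in> {1..n l}"
  shows "integrable M (\<lambda>\<omega>. X l a \<omega> * X l b \<omega>)"
    and "expectation (\<lambda>\<omega>. X l a \<omega> * X l b \<omega>) = of_bool (a = b)"
proof -
  have indep: "indep_vars (\<lambda>_. borel) (X l) {1..n l}"
    and int: "\<And>j. j \<in> {1..n l} \<Longrightarrow> integrable M (X l j)"
    and mean: "\<And>j. j \<in> {1..n l} \<Longrightarrow> expectation (X l j) = 0"
    and var: "\<And>j. j \<in> {1..n l} \<Longrightarrow> variance (X l j) = 1"
    using entries[OF l] unfolding indep_standardized_entries_def by blast+
  have "integrable M (\<lambda>\<omega>. X l a \<omega> * X l b \<omega>) \<and> expectation (\<lambda>\<omega>. X l a \<omega> * X l b \<omega>) = of_bool (a = b)"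
  proof (cases "a = b")
    case True
    have "expectation (\<lambda>\<omega>. X l a \<omega> * X l a \<omega>) = 1"
      using var[OF ab(1)] mean[OF ab(1)] by (simp add: power2_eq_square)
    moreover from this have "integrable M (\<lambda>\<omega>. X l a \<omega> * X l a \<omega>)"
      using not_integrable_integral_eq by fastforce
    ultimately show ?thesis using True by simp
  next
    case False
    have sub: "indep_vars (\<lambda>_. borel) (X l) {a, b}"
      using indep ab by (auto intro: indep_vars_subset)
    have int': "\<And>j. j \<in> {a, b} \<Longrightarrow> integrable M (X l j)" using int ab by auto
    show ?thesis
      using indep_vars_lebesgue_integral[OF _ sub int'] indep_vars_integrable[OF _ sub int'] False mean ab
      by simp
  qed
  then show "integrable M (\<lambda>\<omega>. X l a \<omega> * X l b \<omega>)"
    and "expectation (\<lambda>\<omega>. X l a \<omega> * X l b \<omega>) = of_bool (a = b)" by auto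
qed

text \<open>
  Each factor is a function of one vector, and different vectors are independent.
\<close>
lemma mode_product_moment:
  assumes i: "i \<in> multi_idx n {1..d}" "i' \<in> multi_idx n {1..d}"
  shows "integrable M (\<lambda>\<omega>. \<Prod>l\<in>{1..d}. X l (i l) \<omega> * X l (i' l) \<omega>)"
    and "expectation (\<lambda>\<omega>. \<Prod>l\<in>{1..d}. X l (i l) \<omega> * X l (i' l) \<omega>) = (\<Prod>l\<in>{1..d}. of_bool (i l = i' l))"
proof -
  have mem: "i l \<in> {1..n l}" "i' l \<in> {1..n l}" if "l \<in> {1..d}" for l
    using that multi_idx_memD i by auto
  define Y where "Y l = (\<lambda>v. v (i l) * v (i' l) :: real)" for l
  have "Y l \<in> borel_measurable (vec_space (n l))" if "l \<in> {1..d}" for l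
    unfolding Y_def vec_space_def
    by (intro borel_measurable_times measurable_component_singleton mem that)
  then have indep: "indep_vars (\<lambda>_. borel) (\<lambda>l \<omega>. Y l (rand_vec (n l) (X l) \<omega>)) {1..d}"
    using vecs unfolding indep_rand_vecs_def by (rule indep_vars_compose2[rotated])
  have Y: "Y l (rand_vec (n l) (X l) \<omega>) = X l (i l) \<omega> * X l (i' l) \<omega>" if "l \<in> {1..d}" for l \<omega>
    using mem[OF that] by (simp add: Y_def rand_vec_def)
  have int: "integrable M (\<lambda>\<omega>. Y l (rand_vec (n l) (X l) \<omega>))" if "l \<in> {1..d}" for l
    unfolding Y[OF that] by (intro entry_product_moment that mem)
  have prod: "(\<lambda>\<omega>. \<Prod>l\<in>{1..d}. X l (i l) \<omega> * X l (i' l) \<omega>) = (\<lambda>\<omega>. \<Prod>l\<in>{1..d}. Y l (rand_vec (n l) (X l) \<omega>))"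
    by (intro ext prod.cong refl Y[symmetric])
  show "integrable M (\<lambda>\<omega>. \<Prod>l\<in>{1..d}. X l (i l) \<omega> * X l (i' l) \<omega>)"
    unfolding prod by (rule indep_vars_integrable[OF finite_atLeastAtMost indep int])
  have "expectation (\<lambda>\<omega>. \<Prod>l\<in>{1..d}. X l (i l) \<omega> * X l (i' l) \<omega>)
      = (\<Prod>l\<in>{1..d}. expectation (\<lambda>\<omega>. Y l (rand_vec (n l) (X l) \<omega>)))"
    unfolding prod by (rule indep_vars_lebesgue_integral[OF finite_atLeastAtMost indep int])
  also have "\<dots> = (\<Prod>l\<in>{1..d}. of_bool (i l = i' l))"
  proof (rule prod.cong[OF refl])
    fix l assume l: "l \<in> {1..d}"
    show "expectation (\<lambda>\<omega>. Y l (rand_vec (n l) (X l) \<omega>)) = of_bool (i l = i' l)"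
      unfolding Y[OF l] by (rule entry_product_moment(2)[OF l mem[OF l]])
  qed
  finally show "expectation (\<lambda>\<omega>. \<Prod>l\<in>{1..d}. X l (i l) \<omega> * X l (i' l) \<omega>) = (\<Prod>l\<in>{1..d}. of_bool (i l = i' l))" .
qed

text \<open>
  Only index pairs that agree in every mode have a nonzero moment, and this is the term of the expansion
  with all modes on the diagonal and no centred square.
\<close>
lemma expectation_quadratic_form:
  "expectation (\<lambda>\<omega>. \<Sum>i\<in>multi_idx n {1..d}. \<Sum>i'\<in>multi_idx n {1..d}.
      A (dot_plus d i i') * (\<Prod>l\<in>{1..d}. X l (i l) \<omega> * X l (i' l) \<omega>))
   = chaos_term d n A {1..d} {} w x y"
proof -
  let ?J = "multi_idx n {1..d}"
  have "expectation (\<lambda>\<omega>. \<Sum>i\<in>?J. \<Sum>i'\<in>?J. A (dot_plus d i i') * (\<Prod>l\<in>{1..d}. X l (i l) \<omega> * X l (i' l) \<omega>))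
      = (\<Sum>i\<in>?J. expectation (\<lambda>\<omega>. \<Sum>i'\<in>?J. A (dot_plus d i i') * (\<Prod>l\<in>{1..d}. X l (i l) \<omega> * X l (i' l) \<omega>)))"
    by (rule Bochner_Integration.integral_sum)
       (intro Bochner_Integration.integrable_sum integrable_mult_right mode_product_moment)
  also have "\<dots> = (\<Sum>i\<in>?J. \<Sum>i'\<in>?J. expectation (\<lambda>\<omega>. A (dot_plus d i i') * (\<Prod>l\<in>{1..d}. X l (i l) \<omega> * X l (i' l) \<omega>)))"
    by (intro sum.cong refl Bochner_Integration.integral_sum integrable_mult_right mode_product_moment)
  also have "\<dots> = (\<Sum>i\<in>?J. \<Sum>i'\<in>?J. A (dot_plus d i i') * (\<Prod>l\<in>{1..d}. of_bool (i l = i' l)))"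
  proof (rule sum.cong[OF refl], rule sum.cong[OF refl])
    fix i i' assume i: "i \<in> ?J" "i' \<in> ?J"
    show "expectation (\<lambda>\<omega>. A (dot_plus d i i') * (\<Prod>l\<in>{1..d}. X l (i l) \<omega> * X l (i' l) \<omega>))
        = A (dot_plus d i i') * (\<Prod>l\<in>{1..d}. of_bool (i l = i' l))"
      using mode_product_moment[OF i] by (simp only: integral_mult_right_zero)
  qed
  also have "\<dots> = chaos_term d n A {1..d} {} w x y"
    by (simp only: chaos_term_def Diff_cancel prod.empty mult_1_right)
  finally show ?thesis .
qed

lemma copied_product_factor_law:
  assumes "p \<ge> 1"
  shows "copied_product d n (factor_law M d n X) p"
proof (rule copied_product.intro)
  fix k :: "(nat + nat) \<times> nat"
  obtain c j where k: "k = (c, j)" by (cases k)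
  define l where "l = case_sum id id c"
  have l: "l \<in> {1..d}" "j \<in> {1..n l}" if "k \<in> coords d n"
    using that by (auto simp: k l_def coords_def)
  have law: "factor_law M d n X k = distr M borel (X l j)" if "k \<in> coords d n"
    using that by (simp add: factor_law_def k l_def)
  show "prob_space (factor_law M d n X k)"
  proof (cases "k \<in> coords d n")
    case True
    then show ?thesis unfolding law[OF True] using l entry_measurable by (intro prob_space_distr) auto
  qed (simp add: factor_law_def prob_space_return)
  show "sets (factor_law M d n X k) = sets borel"
    by (simp add: factor_law_def k)
  assume kc: "k \<in> coords d n"
  have "integrable M (X l j)" "expectation (X l j) = 0"
    using entries[OF l(1)[OF kc]] l(2)[OF kc] unfolding indep_standardized_entries_def by auto
  then show "integrable (factor_law M d n X k) (\<lambda>y. y)" "(\<integral>y. y \<partial>factor_law M d n X k) = 0"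
    unfolding law[OF kc] using entry_measurable[OF l[OF kc]]
    by (simp_all add: integrable_distr_eq integral_distr)
next
  fix l j
  show "factor_law M d n X (Inr l, j) = factor_law M d n X (Inl l, j)"
    by (simp add: factor_law_def)
qed (rule assms)

text \<open>
  Both norms only depend on the joint law of the entries, so the inequality on the product space
  carries over.
\<close>
lemma offdiag_term_bound:
  assumes p: "p \<ge> 1" and IJ: "J \<subseteq> I" "I \<subseteq> {1..d}"
  shows "Lp_norm M p (\<lambda>\<omega>. chaos_term d n A I J (\<lambda>_ a b. of_bool (a \<noteq> b)) (\<lambda>l j. X l j \<omega>) (\<lambda>l j. X l j \<omega>))
    \<le> 4 ^ (d - card I) *
      Lp_norm M p (\<lambda>\<omega>. chaos_term d n A I J (\<lambda>_ _ _. 1) (\<lambda>l j. X l j \<omega>) (\<lambda>l j. Xbar l j \<omega>))"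
proof -
  interpret cp: copied_product d n "factor_law M d n X" p
    by (rule copied_product_factor_law[OF p])
  let ?Z = "sample d n X Xbar"
  have J: "J \<subseteq> {1..d}" using IJ by auto
  have transfer: "Lp_norm cp.P p F = Lp_norm M p (\<lambda>\<omega>. F (?Z \<omega>))" if "F \<in> borel_measurable cp.P" for F
    using Lp_norm_distr[OF sample_measurable that] by (simp only: distr_sample)
  have orig: "chaos_term d n A I J w (original (?Z \<omega>)) (original (?Z \<omega>))
      = chaos_term d n A I J w (\<lambda>l j. X l j \<omega>) (\<lambda>l j. X l j \<omega>)" for w \<omega>
    using J by (intro chaos_term_cong) (auto simp: sample_def)
  have copied: "chaos_term d n A I J w (original (?Z \<omega>)) (copy (?Z \<omega>))
      = chaos_term d n A I J w (\<lambda>l j. X l j \<omega>) (\<lambda>l j. Xbar l j \<omega>)" for w \<omega>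
    using J by (intro chaos_term_cong) (auto simp: sample_def)
  show ?thesis
    using cp.offdiag_chaos_decoupling[OF IJ, of A]
    unfolding transfer[OF cp.chaos_measurable(1)[OF J]] transfer[OF cp.chaos_measurable(2)[OF J]] orig copied .
qed

lemma chaos_X_measurable:
  assumes "J \<subseteq> {1..d}"
  shows "(\<lambda>\<omega>. chaos_term d n A I J w (\<lambda>l j. X l j \<omega>) (\<lambda>l j. X l j \<omega>)) \<in> borel_measurable M"
  using assms entry_measurable by (intro chaos_term_measurable) auto

end

section \<open>The decoupling inequality\<close>

theorem theorem2p5:
  fixes M :: "'a measure" and p :: real and d :: nat and n :: "nat \<Rightarrow> nat"
    and A :: "(nat \<Rightarrow> nat) \<Rightarrow> real"
    and X Xbar :: "nat \<Rightarrow> nat \<Rightarrow> 'a \<Rightarrow> real"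
  assumes "prob_space M"
    and "p \<ge> 1"
    and "indep_rand_vecs M d n X"
    and "\<And>l. l \<in> {1..d} \<Longrightarrow> indep_standardized_entries M (n l) (X l)"
    and "corresponding_indep_copies M d n X Xbar"
  shows
    "Lp_norm M p (\<lambda>\<omega>.
        (\<Sum>i\<in>multi_idx n {1..d}. \<Sum>i'\<in>multi_idx n {1..d}.
           A (dot_plus d i i') * (\<Prod>l\<in>{1..d}. X l (i l) \<omega> * X l (i' l) \<omega>))
        - prob_space.expectation M (\<lambda>\<omega>'.
            \<Sum>i\<in>multi_idx n {1..d}. \<Sum>i'\<in>multi_idx n {1..d}.
              A (dot_plus d i i') * (\<Prod>l\<in>{1..d}. X l (i l) \<omega>' * X l (i' l) \<omega>')))
     \<le> (\<Sum>(I, J)\<in>{(I, J). I \<subseteq> {1..d} \<and> J \<subseteq> {1..d} \<and> J \<subseteq> I \<and> I - J \<noteq> {1..d}}.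
          4 ^ (d - card I) *
          Lp_norm M p (\<lambda>\<omega>.
            \<Sum>i\<in>multi_idx n J. \<Sum>j\<in>multi_idx n (I - J).
            \<Sum>k\<in>multi_idx n ({1..d} - I). \<Sum>k'\<in>multi_idx n ({1..d} - I).
              A (dot_plus d
                   (merge I ({1..d} - I) (merge J (I - J) (i, j), k))
                   (merge I ({1..d} - I) (merge J (I - J) (i, j), k')))
              * (\<Prod>l\<in>J. (X l (i l) \<omega>)\<^sup>2 - 1)
              * (\<Prod>l\<in>{1..d} - I. X l (k l) \<omega> * Xbar l (k' l) \<omega>)))"
proof -
  let ?E = "{(I, J). I \<subseteq> {1..d} \<and> J \<subseteq> {1..d} \<and> J \<subseteq> I \<and> I - J \<noteq> {1..d}}"
  let ?offdiag = "\<lambda>(I, J) \<omega>. chaos_term d n A I J (\<lambda>_ a b. of_bool (a \<noteq> b)) (\<lambda>l j. X l j \<omega>) (\<lambda>l j. X l j \<omega>)"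
  let ?bound = "\<lambda>(I, J). 4 ^ (d - card I) * Lp_norm M p (\<lambda>\<omega>.
            \<Sum>i\<in>multi_idx n J. \<Sum>j\<in>multi_idx n (I - J).
            \<Sum>k\<in>multi_idx n ({1..d} - I). \<Sum>k'\<in>multi_idx n ({1..d} - I).
              A (dot_plus d
                   (merge I ({1..d} - I) (merge J (I - J) (i, j), k))
                   (merge I ({1..d} - I) (merge J (I - J) (i, j), k')))
              * (\<Prod>l\<in>J. (X l (i l) \<omega>)\<^sup>2 - 1)
              * (\<Prod>l\<in>{1..d} - I. X l (k l) \<omega> * Xbar l (k' l) \<omega>))"
  have fin: "finite ?E"
    by (rule finite_subset[of _ "Pow {1..d} \<times> Pow {1..d}"]) auto
  \<comment> \<open>The one pair with \<open>I - J = {1..d}\<close>, whose term is the expectation.\<close>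
  have pairs: "Sigma (Pow {1..d}) Pow = insert ({1..d}, {}) ?E" "({1..d}, {}) \<notin> ?E"
    by auto
  have "(\<Sum>i\<in>multi_idx n {1..d}. \<Sum>i'\<in>multi_idx n {1..d}.
           A (dot_plus d i i') * (\<Prod>l\<in>{1..d}. X l (i l) \<omega> * X l (i' l) \<omega>))
        - prob_space.expectation M (\<lambda>\<omega>'.
            \<Sum>i\<in>multi_idx n {1..d}. \<Sum>i'\<in>multi_idx n {1..d}.
              A (dot_plus d i i') * (\<Prod>l\<in>{1..d}. X l (i l) \<omega>' * X l (i' l) \<omega>'))
      = (\<Sum>IJ\<in>?E. ?offdiag IJ \<omega>)" for \<omega>
  proof -
    have "(\<Sum>i\<in>multi_idx n {1..d}. \<Sum>i'\<in>multi_idx n {1..d}.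
           A (dot_plus d i i') * (\<Prod>l\<in>{1..d}. X l (i l) \<omega> * X l (i' l) \<omega>))
      = (\<Sum>I\<in>Pow {1..d}. \<Sum>J\<in>Pow I. ?offdiag (I, J) \<omega>)"
      using sum_chaos_terms[where x = "\<lambda>l j. X l j \<omega>"] by simp
    also have "\<dots> = (\<Sum>IJ\<in>Sigma (Pow {1..d}) Pow. ?offdiag IJ \<omega>)"
      by (subst sum.Sigma) (auto simp: case_prod_unfold intro: finite_subset)
    also have "\<dots> = ?offdiag ({1..d}, {}) \<omega> + (\<Sum>IJ\<in>?E. ?offdiag IJ \<omega>)"
      unfolding pairs(1) by (rule sum.insert[OF fin pairs(2)])
    finally show ?thesis
      using expectation_quadratic_form[OF assms(1,3,4,5), where w = "\<lambda>_ a b. of_bool (a \<noteq> b)"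
          and x = "\<lambda>l j. X l j \<omega>" and y = "\<lambda>l j. X l j \<omega>"] by simp
  qed
  then have "Lp_norm M p (\<lambda>\<omega>.
        (\<Sum>i\<in>multi_idx n {1..d}. \<Sum>i'\<in>multi_idx n {1..d}.
           A (dot_plus d i i') * (\<Prod>l\<in>{1..d}. X l (i l) \<omega> * X l (i' l) \<omega>))
        - prob_space.expectation M (\<lambda>\<omega>'.
            \<Sum>i\<in>multi_idx n {1..d}. \<Sum>i'\<in>multi_idx n {1..d}.
              A (dot_plus d i i') * (\<Prod>l\<in>{1..d}. X l (i l) \<omega>' * X l (i' l) \<omega>')))
      = Lp_norm M p (\<lambda>\<omega>. \<Sum>IJ\<in>?E. ?offdiag IJ \<omega>)"
    by (simp only:)
  also have "\<dots> \<le> (\<Sum>IJ\<in>?E. Lp_norm M p (?offdiag IJ))"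
    using chaos_X_measurable[OF assms(1,3,4,5)]
    by (intro Lp_norm_sum_le[OF assms(2) fin]) auto
  also have "\<dots> \<le> (\<Sum>IJ\<in>?E. ?bound IJ)"
  proof (rule sum_mono)
    fix IJ assume "IJ \<in> ?E"
    then obtain I J where eq: "IJ = (I, J)" and IJ: "J \<subseteq> I" "I \<subseteq> {1..d}" by blast
    show "Lp_norm M p (?offdiag IJ) \<le> ?bound IJ"
      using offdiag_term_bound[OF assms(1,3,4,5,2) IJ, of A]
      unfolding chaos_term_collapse[OF IJ] eq prod.case .
  qed
  finally show ?thesis .
qed

end
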